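(* For every $\Delta^0_2$ increasing function $g : \omega\to\omega$, there is an infinite $g$-transitive set $H$ of low degree (i.e., $H' \leq_T \emptyset'$).
   Context: Given $g$, an interval $[a,b]$ is $g$-large if $b \geq g(a)$ and $g$-small otherwise; a set $H$ is $g$-transitive if for every $x<y<z$ in $H$ with $[x,y]$ and $[y,z]$ $g$-small, $[x,z]$ is $g$-small. *)

theory Defs
  imports Main "HOL-Library.Nat_Bijection"
begin

section \<open>Computability relative to an oracle\<close>

text \<open>
  The partial recursive functions relative to an oracle, as partial functions on the naturals.
  Several arguments are coded as one by the (computable, bijective) Cantor pairing
  \<^const>\<open>prod_encode\<close>, so no arities are needed; the identity is \<open>PairOf Left Right\<close>.
\<close>

datatype prog =
    Zero
  | Succ
  | Left
  | Right
  | Query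
  | PairOf prog prog
  | Comp prog prog
  | Prec prog prog
  | Mu prog

primrec run :: "nat set \<Rightarrow> prog \<Rightarrow> nat \<Rightarrow> nat option" where
  "run A Zero x = Some 0"
| "run A Succ x = Some (Suc x)"
| "run A Left x = Some (fst (prod_decode x))"
| "run A Right x = Some (snd (prod_decode x))"
| "run A Query x = Some (if x \<in> A then 1 else 0)"
| "run A (PairOf p q) x =
     Option.bind (run A p x) (\<lambda>a. Option.bind (run A q x) (\<lambda>b. Some (prod_encode (a, b))))"
| "run A (Comp p q) x = Option.bind (run A q x) (run A p)"
| "run A (Prec p q) x =
     (case prod_decode x of (a, n) \<Rightarrow>
        rec_nat (run A p a)
          (\<lambda>m r. Option.bind r (\<lambda>v. run A q (prod_encode (a, prod_encode (m, v))))) n)"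
| "run A (Mu p) x =
     (if \<exists>n. run A p (prod_encode (x, n)) = Some 0 \<and>
             (\<forall>m<n. run A p (prod_encode (x, m)) \<noteq> None)
      then Some (LEAST n. run A p (prod_encode (x, n)) = Some 0)
      else None)"

text \<open>
  An effective numbering of the programs: \<open>prog_of e\<close> is the program with index \<open>e\<close>.
  Indices below 5 are the basic functions; otherwise \<open>(e - 5) mod 4\<close> gives the constructor
  and \<open>(e - 5) div 4\<close> the (pair of) indices of its arguments.
\<close>

function prog_of :: "nat \<Rightarrow> prog" where
  "prog_of e =
     (if e = 0 then Zero
      else if e = 1 then Succ
      else if e = 2 then Left
      else if e = 3 then Right
      else if e = 4 then Query
      else
        let m = (e - 5) div 4; i = fst (prod_decode m); j = snd (prod_decode m) in
        if (e - 5) mod 4 = 0 then PairOf (prog_of i) (prog_of j)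
        else if (e - 5) mod 4 = 1 then Comp (prog_of i) (prog_of j)
        else if (e - 5) mod 4 = 2 then Prec (prog_of i) (prog_of j)
        else Mu (prog_of m))"
  by pat_completeness auto

lemma fst_prod_decode_le: "fst (prod_decode m) \<le> m"
  by (metis le_prod_encode_1 prod.collapse prod_decode_inverse)

lemma snd_prod_decode_le: "snd (prod_decode m) \<le> m"
  by (metis le_prod_encode_2 prod.collapse prod_decode_inverse)

termination prog_of
proof (relation "measure id")
  fix e m i j :: nat
  assume e: "e \<noteq> 0" and m: "m = (e - 5) div 4"
  have lt: "m < e"
    using e unfolding m by linarith
  show "(m, e) \<in> measure id"
    using lt by simp
  { assume "i = fst (prod_decode m)"
    then show "(i, e) \<in> measure id" "(i, e) \<in> measure id" "(i, e) \<in> measure id"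
      using lt fst_prod_decode_le[of m] by simp_all }
  { assume "j = snd (prod_decode m)"
    then show "(j, e) \<in> measure id" "(j, e) \<in> measure id" "(j, e) \<in> measure id"
      using lt snd_prod_decode_le[of m] by simp_all }
qed simp

declare prog_of.simps [simp del]

definition computable_in :: "nat set \<Rightarrow> (nat \<Rightarrow> nat) \<Rightarrow> bool" where
  "computable_in A f \<longleftrightarrow> (\<exists>p. \<forall>x. run A p x = Some (f x))"

definition turing_le :: "nat set \<Rightarrow> nat set \<Rightarrow> bool" (infix "\<le>\<^sub>T" 50) where
  "A \<le>\<^sub>T B \<longleftrightarrow> computable_in B (\<lambda>x. if x \<in> A then 1 else 0)"

definition turing_jump :: "nat set \<Rightarrow> nat set" where
  "turing_jump A = {e. run A (prog_of e) e \<noteq> None}"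

definition low :: "nat set \<Rightarrow> bool" where
  "low A \<longleftrightarrow> turing_jump A \<le>\<^sub>T turing_jump {}"


section \<open>The arithmetical hierarchy\<close>

primrec arith_Sigma :: "nat \<Rightarrow> nat set set" where
  "arith_Sigma 0 = {A. A \<le>\<^sub>T {}}"
| "arith_Sigma (Suc n) = {{x. \<exists>y. prod_encode (x, y) \<in> B} | B. - B \<in> arith_Sigma n}"

definition arith_Pi :: "nat \<Rightarrow> nat set set" where
  "arith_Pi n = {A. - A \<in> arith_Sigma n}"

definition arith_Delta :: "nat \<Rightarrow> nat set set" where
  "arith_Delta n = arith_Sigma n \<inter> arith_Pi n"

text \<open>A function belongs to a class of the hierarchy if its graph does.\<close>

definition Delta_fun :: "nat \<Rightarrow> (nat \<Rightarrow> nat) \<Rightarrow> bool" where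
  "Delta_fun n f \<longleftrightarrow> {prod_encode (x, f x) | x. True} \<in> arith_Delta n"


section \<open>Large and small intervals\<close>

definition g_large :: "(nat \<Rightarrow> nat) \<Rightarrow> nat \<Rightarrow> nat \<Rightarrow> bool" where
  "g_large g a b \<longleftrightarrow> b \<ge> g a"

definition g_small :: "(nat \<Rightarrow> nat) \<Rightarrow> nat \<Rightarrow> nat \<Rightarrow> bool" where
  "g_small g a b \<longleftrightarrow> \<not> g_large g a b"

definition g_transitive :: "(nat \<Rightarrow> nat) \<Rightarrow> nat set \<Rightarrow> bool" where
  "g_transitive g H \<longleftrightarrow>
     (\<forall>x\<in>H. \<forall>y\<in>H. \<forall>z\<in>H. x < y \<and> y < z \<and> g_small g x y \<and> g_small g y z \<longrightarrow> g_small g x z)"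

end

theory Submission imports Defs begin

text \<open>
  The set \<open>H\<close> is built by finite extensions \<open>C s\<close>, computably in the jump of the empty set. A
  condition consists of a finite stem \<open>F\<close>, a bound \<open>n\<close> for new elements, and a finite set \<open>Z\<close> of
  indices declared to diverge; it is valid if \<open>F\<close> is \<open>g\<close>-transitive and \<open>g\<close>-large to everything
  above \<open>n\<close>, and if there are finitely many monotone notions of largeness such that no finite
  set above \<open>n\<close> which is transitive for all of them makes an index in \<open>Z\<close> converge. By
  compactness the existence of these notions is a \<open>\<Pi>\<^sub>1\<close> question, so that validity is decidable in
  the jump, although asking the same for \<open>g\<close> alone would be more complex. To decide the index \<open>s\<close>,
  either some notion of largeness prevents convergence and is added to the list, or none does, and
  in particular that of \<open>g\<close> does not, so that a \<open>g\<close>-transitive extension makes \<open>s\<close> converge. The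
  jump of \<open>H\<close> is read off from the sets \<open>Z\<close>.
\<close>

section \<open>Closure properties of computable functions\<close>

lemma computable_in_id: "computable_in A (\<lambda>x. x)"
  unfolding computable_in_def by (rule exI[of _ "PairOf Left Right"]) simp

lemma computable_in_comp:
  assumes "computable_in A f" "computable_in A g"
  shows "computable_in A (\<lambda>x. f (g x))"
proof -
  obtain p q where "\<forall>x. run A p x = Some (f x)" "\<forall>x. run A q x = Some (g x)"
    using assms unfolding computable_in_def by blast
  then show ?thesis
    unfolding computable_in_def by (intro exI[of _ "Comp p q"]) simp
qed

lemma computable_in_Suc:
  assumes "computable_in A f"
  shows "computable_in A (\<lambda>x. Suc (f x))"
proof (rule computable_in_comp[OF _ assms])
  show "computable_in A Suc"
    unfolding computable_in_def by (rule exI[of _ Succ]) simp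
qed

lemma computable_in_const: "computable_in A (\<lambda>x. n)"
proof (induction n)
  case 0
  show ?case unfolding computable_in_def by (rule exI[of _ Zero]) simp
next
  case (Suc n)
  then show ?case by (rule computable_in_Suc)
qed

lemma computable_in_pair:
  assumes "computable_in A f" "computable_in A g"
  shows "computable_in A (\<lambda>x. prod_encode (f x, g x))"
proof -
  obtain p q where "\<forall>x. run A p x = Some (f x)" "\<forall>x. run A q x = Some (g x)"
    using assms unfolding computable_in_def by blast
  then show ?thesis
    unfolding computable_in_def by (intro exI[of _ "PairOf p q"]) simp
qed

lemma computable_in_fst:
  assumes "computable_in A f"
  shows "computable_in A (\<lambda>x. fst (prod_decode (f x)))"
proof (rule computable_in_comp[OF _ assms])
  show "computable_in A (\<lambda>x. fst (prod_decode x))"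
    unfolding computable_in_def by (rule exI[of _ Left]) simp
qed

lemma computable_in_snd:
  assumes "computable_in A f"
  shows "computable_in A (\<lambda>x. snd (prod_decode (f x)))"
proof (rule computable_in_comp[OF _ assms])
  show "computable_in A (\<lambda>x. snd (prod_decode x))"
    unfolding computable_in_def by (rule exI[of _ Right]) simp
qed

text \<open>\<open>Prec\<close> keeps its parameter in the first component of its argument, so
  pairing \<open>x\<close> with \<open>h x\<close> lets the start, the step and the length of the
  recursion all depend on \<open>x\<close>. The step is taken as a function of the coded triple of
  parameter, counter and previous value.\<close>

lemma computable_in_rec:
  assumes f: "computable_in A f" and h: "computable_in A h"
    and q: "computable_in A (\<lambda>e. q (fst (prod_decode e)) (fst (prod_decode (snd (prod_decode e))))
              (snd (prod_decode (snd (prod_decode e)))))"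
  shows "computable_in A (\<lambda>x. rec_nat (f x) (\<lambda>m r. q x m r) (h x))"
proof -
  obtain p p' where p: "\<And>x. run A p x = Some (f x)"
    and p': "\<And>x. run A p' x = Some (q (fst (prod_decode x)) (fst (prod_decode (snd (prod_decode x))))
              (snd (prod_decode (snd (prod_decode x)))))"
    using f q unfolding computable_in_def by blast
  have step: "run A (Prec p p') (prod_encode (x, n)) = Some (rec_nat (f x) (\<lambda>m r. q x m r) n)" for x n
    by (induction n) (simp_all add: p p')
  have "computable_in A (\<lambda>e. rec_nat (f (fst (prod_decode e))) (\<lambda>m r. q (fst (prod_decode e)) m r)
          (snd (prod_decode e)))"
    unfolding computable_in_def
    by (rule exI[of _ "Prec p p'"]) (metis step prod.collapse prod_decode_inverse)
  from computable_in_comp[OF this computable_in_pair[OF computable_in_id h]]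
  show ?thesis by simp
qed

section \<open>Arithmetic functions\<close>

named_theorems computable

lemmas [computable] = computable_in_id computable_in_const computable_in_Suc computable_in_pair
  computable_in_fst computable_in_snd

lemma computable_in_add [computable]:
  assumes "computable_in A f" "computable_in A g"
  shows "computable_in A (\<lambda>x. f x + g x)"
proof -
  have "rec_nat a (\<lambda>m r. Suc r) b = a + b" for a b by (induction b) auto
  moreover have "computable_in A (\<lambda>x. rec_nat (f x) (\<lambda>m r. Suc r) (g x))"
    by (intro computable_in_rec computable assms)
  ultimately show ?thesis by simp
qed

lemma computable_in_pred:
  assumes "computable_in A f"
  shows "computable_in A (\<lambda>x. f x - 1)"
proof -
  have "rec_nat 0 (\<lambda>m r. m) b = b - 1" for b :: nat by (cases b) auto
  moreover have "computable_in A (\<lambda>x. rec_nat 0 (\<lambda>m r. m) (f x))"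
    by (intro computable_in_rec computable assms)
  ultimately show ?thesis by simp
qed

lemma computable_in_diff [computable]:
  assumes "computable_in A f" "computable_in A g"
  shows "computable_in A (\<lambda>x. f x - g x)"
proof -
  have "rec_nat a (\<lambda>m r. r - 1) b = a - b" for a b :: nat by (induction b) auto
  moreover have "computable_in A (\<lambda>x. rec_nat (f x) (\<lambda>m r. r - 1) (g x))"
    by (intro computable_in_rec computable_in_pred computable assms)
  ultimately show ?thesis by simp
qed

lemma computable_in_mult [computable]:
  assumes "computable_in A f" "computable_in A g"
  shows "computable_in A (\<lambda>x. f x * g x)"
proof -
  have "rec_nat 0 (\<lambda>m r. r + a) b = a * b" for a b :: nat by (induction b) auto
  moreover have "computable_in A (\<lambda>x. rec_nat 0 (\<lambda>m r. r + f x) (g x))"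
    by (intro computable_in_rec computable assms computable_in_comp[OF assms(1)])
  ultimately show ?thesis by simp
qed

lemma computable_in_power [computable]:
  assumes "computable_in A f" "computable_in A g"
  shows "computable_in A (\<lambda>x. f x ^ g x)"
proof -
  have "rec_nat 1 (\<lambda>m r. r * a) b = a ^ b" for a b :: nat by (induction b) auto
  moreover have "computable_in A (\<lambda>x. rec_nat 1 (\<lambda>m r. r * f x) (g x))"
    by (intro computable_in_rec computable assms computable_in_comp[OF assms(1)])
  ultimately show ?thesis by simp
qed

lemma computable_in_cong:
  assumes "computable_in A f" "\<And>x. g x = f x"
  shows "computable_in A g"
proof -
  have "g = f" using assms(2) by (rule ext)
  then show ?thesis using assms(1) by (simp only:)
qed

section \<open>Decidable predicates and bounded quantifiers\<close>

definition decidable_in :: "nat set \<Rightarrow> (nat \<Rightarrow> bool) \<Rightarrow> bool" where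
  "decidable_in A P \<longleftrightarrow> computable_in A (\<lambda>x. if P x then 1 else 0)"

lemma decidable_in_comp:
  assumes "decidable_in A P" "computable_in A g"
  shows "decidable_in A (\<lambda>x. P (g x))"
  using computable_in_comp[OF assms(1)[unfolded decidable_in_def] assms(2)]
  unfolding decidable_in_def .

lemma decidable_in_not [computable]:
  assumes "decidable_in A P"
  shows "decidable_in A (\<lambda>x. \<not> P x)"
proof -
  have "computable_in A (\<lambda>x. 1 - (if P x then 1 else 0))"
    using assms unfolding decidable_in_def by (intro computable)
  then show ?thesis unfolding decidable_in_def by (rule computable_in_cong) auto
qed

lemma decidable_in_conj [computable]:
  assumes "decidable_in A P" "decidable_in A Q"
  shows "decidable_in A (\<lambda>x. P x \<and> Q x)"
proof -
  have "computable_in A (\<lambda>x. (if P x then 1 else 0) * (if Q x then 1 else 0))"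
    using assms unfolding decidable_in_def by (intro computable)
  then show ?thesis unfolding decidable_in_def by (rule computable_in_cong) auto
qed

lemma decidable_in_disj [computable]:
  assumes "decidable_in A P" "decidable_in A Q"
  shows "decidable_in A (\<lambda>x. P x \<or> Q x)"
proof -
  have "decidable_in A (\<lambda>x. \<not> (\<not> P x \<and> \<not> Q x))" by (intro computable assms)
  then show ?thesis by simp
qed

lemma decidable_in_imp [computable]:
  assumes "decidable_in A P" "decidable_in A Q"
  shows "decidable_in A (\<lambda>x. P x \<longrightarrow> Q x)"
proof -
  have "decidable_in A (\<lambda>x. \<not> P x \<or> Q x)" by (intro computable assms)
  then show ?thesis unfolding imp_conv_disj .
qed

lemma decidable_in_le [computable]:
  assumes "computable_in A f" "computable_in A g"
  shows "decidable_in A (\<lambda>x. f x \<le> g x)"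
proof -
  have "computable_in A (\<lambda>x. 1 - (f x - g x))" by (intro computable assms)
  then show ?thesis unfolding decidable_in_def by (rule computable_in_cong) auto
qed

lemma decidable_in_less [computable]:
  assumes "computable_in A f" "computable_in A g"
  shows "decidable_in A (\<lambda>x. f x < g x)"
  using decidable_in_le[OF computable_in_Suc[OF assms(1)] assms(2)] by (simp add: Suc_le_eq)

lemma decidable_in_eq [computable]:
  assumes "computable_in A f" "computable_in A g"
  shows "decidable_in A (\<lambda>x. f x = g x)"
proof -
  have "decidable_in A (\<lambda>x. f x \<le> g x \<and> g x \<le> f x)" by (intro computable assms)
  moreover have "f x \<le> g x \<and> g x \<le> f x \<longleftrightarrow> f x = g x" for x by auto
  ultimately show ?thesis by (simp only:)
qed

lemma computable_in_if [computable]: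
  assumes "decidable_in A P" "computable_in A f" "computable_in A g"
  shows "computable_in A (\<lambda>x. if P x then f x else g x)"
proof -
  have "computable_in A (\<lambda>x. (if P x then 1 else 0) * f x + (1 - (if P x then 1 else 0)) * g x)"
    by (intro computable assms assms(1)[unfolded decidable_in_def])
  then show ?thesis by (rule computable_in_cong) auto
qed

lemma decidable_in_if [computable]:
  assumes "decidable_in A P" "decidable_in A Q" "decidable_in A R"
  shows "decidable_in A (\<lambda>x. if P x then Q x else R x)"
proof -
  have "decidable_in A (\<lambda>x. (P x \<and> Q x) \<or> (\<not> P x \<and> R x))" by (intro computable assms)
  then show ?thesis unfolding decidable_in_def by (rule computable_in_cong) auto
qed

text \<open>\<open>Mu\<close> looks for a zero, so it is applied to the negated characteristic
  function, which is total. The resulting program diverges exactly where no witness exists; this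
  links unbounded search to the jump.\<close>

lemma decidable_in_Mu:
  assumes "decidable_in A (\<lambda>e. Q (fst (prod_decode e)) (snd (prod_decode e)))"
  obtains p where "\<And>x. run A p x = (if \<exists>n. Q x n then Some (LEAST n. Q x n) else None)"
proof -
  have "computable_in A (\<lambda>e. if Q (fst (prod_decode e)) (snd (prod_decode e)) then 0 else 1)"
    by (intro computable assms)
  then obtain q where q: "\<And>e. run A q e = Some (if Q (fst (prod_decode e)) (snd (prod_decode e)) then 0 else 1)"
    unfolding computable_in_def by blast
  have "(if Q a b then 0 else (1::nat)) = 0 \<longleftrightarrow> Q a b" for a b by simp
  then have "run A (Mu q) x = (if \<exists>n. Q x n then Some (LEAST n. Q x n) else None)" for x
    by (simp add: q)
  then show ?thesis by (rule that)
qed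

lemma computable_in_Least:
  assumes "decidable_in A (\<lambda>e. Q (fst (prod_decode e)) (snd (prod_decode e)))" "\<And>x. \<exists>n. Q x n"
  shows "computable_in A (\<lambda>x. LEAST n. Q x n)"
proof -
  obtain p where "\<And>x. run A p x = (if \<exists>n. Q x n then Some (LEAST n. Q x n) else None)"
    using decidable_in_Mu[OF assms(1)] by blast
  then show ?thesis unfolding computable_in_def by (intro exI[of _ p]) (simp add: assms(2))
qed

text \<open>Search for the first number that is either not below the bound or a counterexample. The
  bound itself stops the search, and it is reached exactly if no counterexample lies below
  it.\<close>

lemma decidable_in_all_less [computable]:
  assumes b: "computable_in A b"
    and P: "decidable_in A (\<lambda>e. P (fst (prod_decode e)) (snd (prod_decode e)))"
  shows "decidable_in A (\<lambda>x. \<forall>i<b x. P x i)"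
proof -
  have "computable_in A (\<lambda>x. LEAST n. b x \<le> n \<or> \<not> P x n)"
    by (rule computable_in_Least) (intro computable P computable_in_comp[OF b], auto)
  then have "decidable_in A (\<lambda>x. b x \<le> (LEAST n. b x \<le> n \<or> \<not> P x n))"
    by (intro computable b)
  moreover have "b x \<le> (LEAST n. b x \<le> n \<or> \<not> P x n) \<longleftrightarrow> (\<forall>i<b x. P x i)" for x
  proof
    assume le: "b x \<le> (LEAST n. b x \<le> n \<or> \<not> P x n)"
    show "\<forall>i<b x. P x i"
      using not_less_Least[of _ "\<lambda>n. b x \<le> n \<or> \<not> P x n"] le by (meson less_le_trans)
  next
    assume "\<forall>i<b x. P x i"
    then show "b x \<le> (LEAST n. b x \<le> n \<or> \<not> P x n)"
      using LeastI[of "\<lambda>n. b x \<le> n \<or> \<not> P x n" "b x"] by (metis not_le order_refl)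
  qed
  ultimately show ?thesis by simp
qed

lemma decidable_in_ex_less [computable]:
  assumes "computable_in A b"
    and "decidable_in A (\<lambda>e. P (fst (prod_decode e)) (snd (prod_decode e)))"
  shows "decidable_in A (\<lambda>x. \<exists>i<b x. P x i)"
proof -
  have "decidable_in A (\<lambda>x. \<not> (\<forall>i<b x. \<not> P x i))" by (intro computable assms)
  then show ?thesis by simp
qed

lemma computable_in_div [computable]:
  assumes "computable_in A f" "computable_in A g"
  shows "computable_in A (\<lambda>x. f x div g x)"
proof -
  \<comment> \<open>The disjunct \<open>g x = 0\<close> makes the search total and yields 0, the
    value of division by zero.\<close>
  have "computable_in A (\<lambda>x. LEAST q. g x = 0 \<or> f x < g x * Suc q)"
  proof (rule computable_in_Least)
    fix x
    have "f x < g x * Suc (f x)" if "g x \<noteq> 0" using that by (cases "g x") auto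
    then show "\<exists>q. g x = 0 \<or> f x < g x * Suc q" by (cases "g x = 0") blast+
  qed (intro computable computable_in_comp[OF assms(1)] computable_in_comp[OF assms(2)])
  moreover have "(LEAST q. k = 0 \<or> m < k * Suc q) = m div k" for m k :: nat
  proof (cases "k = 0")
    case False
    show ?thesis
    proof (rule Least_equality)
      show "k = 0 \<or> m < k * Suc (m div k)"
        using False dividend_less_times_div[of k m] by (simp add: mult.commute)
      show "m div k \<le> q" if "k = 0 \<or> m < k * Suc q" for q
        using that False less_mult_imp_div_less[of m "Suc q" k] by (simp add: mult.commute less_Suc_eq_le)
    qed
  qed (simp add: Least_equality)
  ultimately show ?thesis by simp
qed

lemma computable_in_mod [computable]:
  assumes "computable_in A f" "computable_in A g"
  shows "computable_in A (\<lambda>x. f x mod g x)"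
  unfolding modulo_nat_def minus_mult_div_eq_mod[symmetric] by (intro computable assms)

lemma decidable_in_set_decode [computable]:
  assumes "computable_in A f" "computable_in A g"
  shows "decidable_in A (\<lambda>x. f x \<in> set_decode (g x))"
  unfolding set_decode_def mem_Collect_eq odd_iff_mod_2_eq_one by (intro computable assms)

text \<open>A member \<open>x\<close> contributes \<open>2 ^ x > x\<close> to the code. Quantifiers
  over coded finite sets are therefore bounded.\<close>

lemma set_decode_less: "x \<in> set_decode S \<Longrightarrow> x < S"
  by (metis bot_nat_0.not_eq_extremum div_less even_zero set_decode_def mem_Collect_eq less_exp order_less_le_trans linorder_not_le)

lemma decidable_in_ball_set_decode [computable]:
  assumes "computable_in A b"
    and "decidable_in A (\<lambda>e. P (fst (prod_decode e)) (snd (prod_decode e)))"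
  shows "decidable_in A (\<lambda>x. \<forall>i\<in>set_decode (b x). P x i)"
proof -
  have "decidable_in A (\<lambda>x. \<forall>i<b x. i \<in> set_decode (b x) \<longrightarrow> P x i)"
    by (intro computable assms computable_in_comp[OF assms(1)])
  moreover have "(\<forall>i<b x. i \<in> set_decode (b x) \<longrightarrow> P x i) \<longleftrightarrow> (\<forall>i\<in>set_decode (b x). P x i)" for x
    using set_decode_less by blast
  ultimately show ?thesis by simp
qed

lemma decidable_in_bex_set_decode [computable]:
  assumes "computable_in A b"
    and "decidable_in A (\<lambda>e. P (fst (prod_decode e)) (snd (prod_decode e)))"
  shows "decidable_in A (\<lambda>x. \<exists>i\<in>set_decode (b x). P x i)"
proof -
  have "decidable_in A (\<lambda>x. \<not> (\<forall>i\<in>set_decode (b x). \<not> P x i))" by (intro computable assms)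
  then show ?thesis by simp
qed

section \<open>Program indices and the jump\<close>

text \<open>The constructor number \<open>d\<close> and the argument code \<open>m\<close> are kept
  as variables, so that later case distinctions need not compute with \<open>div\<close> and
  \<open>mod\<close>.\<close>

definition compound_prog :: "nat \<Rightarrow> nat \<Rightarrow> prog" where
  "compound_prog d m =
    (if d = 0 then PairOf (prog_of (fst (prod_decode m))) (prog_of (snd (prod_decode m)))
     else if d = 1 then Comp (prog_of (fst (prod_decode m))) (prog_of (snd (prod_decode m)))
     else if d = 2 then Prec (prog_of (fst (prod_decode m))) (prog_of (snd (prod_decode m)))
     else Mu (prog_of m))"

lemma prog_of_index:
  assumes e: "e = 5 + (d + 4 * m)" and d: "d < 4"
  shows "prog_of e = compound_prog d m"
proof -
  have 4: "(4::nat) \<noteq> 0" by simp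
  have m: "e - 5 = d + 4 * m" by (simp only: e diff_add_inverse)
  have div: "(e - 5) div 4 = m"
    by (simp only: m div_mult_self2[OF 4] div_less[OF d] add_0_right)
  have mod: "(e - 5) mod 4 = d"
    by (simp only: m mod_mult_self2 mod_less[OF d])
  have "5 \<le> e" by (simp only: e le_add1)
  then have ne: "e \<noteq> 0" "e \<noteq> 1" "e \<noteq> 2" "e \<noteq> 3" "e \<noteq> 4" by auto
  show ?thesis
    by (subst prog_of.simps) (simp only: compound_prog_def Let_def div mod ne if_False)
qed

lemma prog_of_compound:
  "prog_of (5 + 4 * prod_encode (i, j)) = PairOf (prog_of i) (prog_of j)"
  "prog_of (6 + 4 * prod_encode (i, j)) = Comp (prog_of i) (prog_of j)"
  "prog_of (7 + 4 * prod_encode (i, j)) = Prec (prog_of i) (prog_of j)"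
  "prog_of (8 + 4 * i) = Mu (prog_of i)"
proof -
  have e: "5 + 4 * m = 5 + (0 + 4 * m)" "6 + 4 * m = 5 + (1 + 4 * m)" "7 + 4 * m = 5 + (2 + 4 * m)"
    "8 + 4 * m = 5 + (3 + 4 * m)" for m :: nat
    by simp_all
  have ne: "(0::nat) < 4" "(1::nat) < 4" "(2::nat) < 4" "(3::nat) < 4" "(1::nat) \<noteq> 0" "(2::nat) \<noteq> 0" "(2::nat) \<noteq> 1"
    "(3::nat) \<noteq> 0" "(3::nat) \<noteq> 1" "(3::nat) \<noteq> 2"
    by simp_all
  note index = prog_of_index[OF e(1) ne(1)] prog_of_index[OF e(2) ne(2)] prog_of_index[OF e(3) ne(3)]
    prog_of_index[OF e(4) ne(4)]
  show "prog_of (5 + 4 * prod_encode (i, j)) = PairOf (prog_of i) (prog_of j)"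
    "prog_of (6 + 4 * prod_encode (i, j)) = Comp (prog_of i) (prog_of j)"
    "prog_of (7 + 4 * prod_encode (i, j)) = Prec (prog_of i) (prog_of j)"
    "prog_of (8 + 4 * i) = Mu (prog_of i)"
    by (simp_all only: index compound_prog_def ne refl if_True if_False prod_encode_inverse fst_conv snd_conv)
qed

lemma ex_prog_of: "\<exists>e. prog_of e = p"
proof (induction p)
  case Zero
  show ?case by (rule exI[of _ 0]) (simp add: prog_of.simps)
next
  case Succ
  show ?case by (rule exI[of _ 1]) (simp add: prog_of.simps)
next
  case Left
  show ?case by (rule exI[of _ 2]) (simp add: prog_of.simps)
next
  case Right
  show ?case by (rule exI[of _ 3]) (simp add: prog_of.simps)
next
  case Query
  show ?case by (rule exI[of _ 4]) (simp add: prog_of.simps)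
next
  case (PairOf p q)
  then obtain i j where "prog_of i = p" "prog_of j = q" by blast
  then show ?case
    by (intro exI[of _ "5 + 4 * prod_encode (i, j)"]) (simp add: prog_of_compound(1))
next
  case (Comp p q)
  then obtain i j where "prog_of i = p" "prog_of j = q" by blast
  then show ?case
    by (intro exI[of _ "6 + 4 * prod_encode (i, j)"]) (simp add: prog_of_compound(2))
next
  case (Prec p q)
  then obtain i j where "prog_of i = p" "prog_of j = q" by blast
  then show ?case
    by (intro exI[of _ "7 + 4 * prod_encode (i, j)"]) (simp add: prog_of_compound(3))
next
  case (Mu p)
  then obtain i where "prog_of i = p" by blast
  then show ?case
    by (intro exI[of _ "8 + 4 * i"]) (simp add: prog_of_compound(4))
qed

text \<open>An explicit instance of the s-m-n theorem: from \<open>x\<close> one computes an index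
  \<open>c x\<close> of a program that ignores its input and searches for a witness for
  \<open>x\<close>. One query to the jump at \<open>c x\<close> answers the question.\<close>

lemma decidable_in_jump_ex:
  assumes "decidable_in A (\<lambda>e. Q (fst (prod_decode e)) (snd (prod_decode e)))"
  shows "decidable_in (turing_jump A) (\<lambda>x. \<exists>n. Q x n)"
proof -
  obtain p where p: "\<And>x. run A p x = (if \<exists>n. Q x n then Some (LEAST n. Q x n) else None)"
    using decidable_in_Mu[OF assms] by blast
  obtain i where i: "prog_of i = p" using ex_prog_of by blast
  \<comment> \<open>\<open>k x\<close> is an index of the constant program with value
    \<open>x\<close>: 0 is the index of \<open>Zero\<close>, and each step composes with
    \<open>Succ\<close>, whose index is 1.\<close>
  define k where "k = rec_nat 0 (\<lambda>m r. 6 + 4 * prod_encode (1, r))"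
  have k: "run A (prog_of (k x)) y = Some x" for x y
  proof (induction x)
    case 0
    show ?case by (simp add: k_def prog_of.simps)
  next
    case (Suc x)
    have "k (Suc x) = 6 + 4 * prod_encode (1, k x)" by (simp add: k_def)
    moreover have "prog_of 1 = Succ" by (simp add: prog_of.simps)
    ultimately show ?case using Suc by (simp only: prog_of_compound(2)) simp
  qed
  define c where "c x = 6 + 4 * prod_encode (i, k x)" for x
  have c: "c x \<in> turing_jump A \<longleftrightarrow> (\<exists>n. Q x n)" for x
    unfolding turing_jump_def c_def mem_Collect_eq prog_of_compound(2) run.simps k i by (simp add: p)
  have "computable_in (turing_jump A) c"
    unfolding c_def[abs_def] k_def by (intro computable computable_in_rec)
  moreover have "decidable_in (turing_jump A) (\<lambda>x. x \<in> turing_jump A)"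
    unfolding decidable_in_def computable_in_def by (rule exI[of _ Query]) simp
  ultimately show ?thesis
    using decidable_in_comp[of "turing_jump A" "\<lambda>x. x \<in> turing_jump A" c] by (simp add: c)
qed

lemma decidable_in_jump_all:
  assumes "decidable_in A (\<lambda>e. Q (fst (prod_decode e)) (snd (prod_decode e)))"
  shows "decidable_in (turing_jump A) (\<lambda>x. \<forall>n. Q x n)"
proof -
  have "decidable_in A (\<lambda>e. \<not> Q (fst (prod_decode e)) (snd (prod_decode e)))"
    by (intro computable assms)
  from decidable_in_not[OF decidable_in_jump_ex[of A "\<lambda>x n. \<not> Q x n", OF this]]
  show ?thesis by simp
qed

text \<open>The graph is the projection of a co-c.e. set \<open>B\<close>, and the jump decides
  \<open>B\<close>. To find \<open>g x\<close>, search for a value together with a witness that it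
  belongs to the graph; totality of \<open>g\<close> makes the search end, and the graph admits only
  the right value.\<close>

lemma Delta_fun_2_computable:
  assumes "Delta_fun 2 g"
  shows "computable_in (turing_jump {}) g"
proof -
  let ?K = "turing_jump {}"
  let ?G = "{prod_encode (x, g x) | x. True}"
  have "?G \<in> arith_Sigma (Suc (Suc 0))"
    using assms unfolding Delta_fun_def arith_Delta_def numeral_2_eq_2 by blast
  then obtain B C where B: "?G = {x. \<exists>y. prod_encode (x, y) \<in> B}"
    and C: "- B = {x. \<exists>y. prod_encode (x, y) \<in> C}" and "- C \<le>\<^sub>T {}"
    by auto
  then have "decidable_in {} (\<lambda>x. x \<in> - C)"
    unfolding turing_le_def decidable_in_def by simp
  from decidable_in_comp[OF this, of "\<lambda>e. prod_encode (fst (prod_decode e), snd (prod_decode e))"]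
  have "decidable_in {} (\<lambda>e. prod_encode (fst (prod_decode e), snd (prod_decode e)) \<in> - C)"
    by (simp add: computable)
  from decidable_in_jump_all[of _ "\<lambda>x y. prod_encode (x, y) \<in> - C", OF this]
  have "decidable_in ?K (\<lambda>x. \<forall>y. prod_encode (x, y) \<in> - C)" .
  moreover have "(\<forall>y. prod_encode (x, y) \<in> - C) \<longleftrightarrow> x \<in> B" for x using C by blast
  ultimately have Bdec: "decidable_in ?K (\<lambda>x. x \<in> B)" by simp
  have gB: "(\<exists>y. prod_encode (prod_encode (x, v), y) \<in> B) \<longleftrightarrow> v = g x" for x v
  proof -
    have "(\<exists>y. prod_encode (prod_encode (x, v), y) \<in> B) \<longleftrightarrow> prod_encode (x, v) \<in> ?G"
      unfolding B by simp
    then show ?thesis by (auto simp: prod_encode_eq)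
  qed
  \<comment> \<open>\<open>w\<close> codes the candidate value and the witness, so that a single
    search runs through both.\<close>
  define Q where "Q x w \<longleftrightarrow> prod_encode (prod_encode (x, fst (prod_decode w)), snd (prod_decode w)) \<in> B" for x w
  have ex: "\<exists>w. Q x w" for x
  proof -
    obtain y where "prod_encode (prod_encode (x, g x), y) \<in> B" using gB by blast
    then show ?thesis by (intro exI[of _ "prod_encode (g x, y)"]) (simp add: Q_def)
  qed
  have "decidable_in ?K (\<lambda>e. Q (fst (prod_decode e)) (snd (prod_decode e)))"
    unfolding Q_def by (intro decidable_in_comp[OF Bdec] computable)
  from computable_in_fst[OF computable_in_Least[OF this ex]]
  have "computable_in ?K (\<lambda>x. fst (prod_decode (LEAST w. Q x w)))" .
  moreover have "fst (prod_decode (LEAST w. Q x w)) = g x" for x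
    using LeastI_ex[OF ex[of x]] gB unfolding Q_def by blast
  ultimately show ?thesis by simp
qed

section \<open>Derivations of computations\<close>

definition triple :: "nat \<Rightarrow> nat \<Rightarrow> nat \<Rightarrow> nat" where
  "triple e x y = prod_encode (e, prod_encode (x, y))"

lemma triple_less: "triple e x y \<in> set_decode S \<Longrightarrow> e < S \<and> x < S \<and> y < S"
  unfolding triple_def
  by (meson le_less_trans le_prod_encode_1 le_prod_encode_2 set_decode_less)

text \<open>One unfolding of \<open>run\<close> for the constructor with number \<open>d\<close>.
  Primitive recursion refers back to its own index \<open>e\<close>, and for minimisation
  \<open>Suc v\<close> expresses that the earlier values are defined and nonzero.\<close>

definition compound_justified :: "nat set \<Rightarrow> nat \<Rightarrow> nat \<Rightarrow> nat \<Rightarrow> nat \<Rightarrow> nat \<Rightarrow> bool" where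
  "compound_justified M e d m x y \<longleftrightarrow>
    (if d = 0 then
       triple (fst (prod_decode m)) x (fst (prod_decode y)) \<in> M \<and>
       triple (snd (prod_decode m)) x (snd (prod_decode y)) \<in> M
     else if d = 1 then
       (\<exists>a. triple (snd (prod_decode m)) x a \<in> M \<and> triple (fst (prod_decode m)) a y \<in> M)
     else if d = 2 then
       (if snd (prod_decode x) = 0 then triple (fst (prod_decode m)) (fst (prod_decode x)) y \<in> M
        else (\<exists>v. triple e (prod_encode (fst (prod_decode x), snd (prod_decode x) - 1)) v \<in> M \<and>
               triple (snd (prod_decode m))
                 (prod_encode (fst (prod_decode x), prod_encode (snd (prod_decode x) - 1, v))) y \<in> M))
     else triple m (prod_encode (x, y)) 0 \<in> M \<and>
       (\<forall>z<y. \<exists>v. triple m (prod_encode (x, z)) (Suc v) \<in> M))"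

text \<open>The triple \<open>(e, x, y)\<close> claims that program \<open>e\<close> maps \<open>x\<close> to \<open>y\<close>. No well-foundedness has
  to be imposed on the claims in \<open>M\<close>: each justification refers to smaller indices, or to the same
  index of a primitive recursion with a smaller recursion argument.\<close>

definition justified :: "nat set \<Rightarrow> nat set \<Rightarrow> nat \<Rightarrow> nat \<Rightarrow> nat \<Rightarrow> bool" where
  "justified A M e x y \<longleftrightarrow>
    (if e = 0 then y = 0
     else if e = 1 then y = Suc x
     else if e = 2 then y = fst (prod_decode x)
     else if e = 3 then y = snd (prod_decode x)
     else if e = 4 then y = (if x \<in> A then 1 else 0)
     else compound_justified M e ((e - 5) mod 4) ((e - 5) div 4) x y)"

definition derivation :: "nat set \<Rightarrow> nat set \<Rightarrow> bool" where
  "derivation A M \<longleftrightarrow>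
    (\<forall>t\<in>M. justified A M (fst (prod_decode t)) (fst (prod_decode (snd (prod_decode t))))
      (snd (prod_decode (snd (prod_decode t)))))"

lemma derivation_triple: "derivation A M \<Longrightarrow> triple e x y \<in> M \<Longrightarrow> justified A M e x y"
  unfolding derivation_def triple_def by fastforce

lemma derivationI:
  assumes "\<And>e x y. triple e x y \<in> M \<Longrightarrow> justified A M e x y"
  shows "derivation A M"
  unfolding derivation_def
proof
  fix t assume "t \<in> M"
  then show "justified A M (fst (prod_decode t)) (fst (prod_decode (snd (prod_decode t))))
      (snd (prod_decode (snd (prod_decode t))))"
    by (intro assms) (simp add: triple_def)
qed

lemma triple_eq: "triple e x y = triple e' x' y' \<longleftrightarrow> e = e' \<and> x = x' \<and> y = y'"
  unfolding triple_def by (simp add: prod_encode_eq)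

text \<open>Membership in \<open>M\<close> occurs only positively. Hence derivations of
  subcomputations can be merged.\<close>

lemma justified_mono: "justified A M e x y \<Longrightarrow> M \<subseteq> M' \<Longrightarrow> justified A M' e x y"
  unfolding justified_def compound_justified_def by (simp split: if_splits; blast)

lemma derivation_Un:
  assumes "derivation A M" "derivation A M'"
  shows "derivation A (M \<union> M')"
  using assms justified_mono[of A M _ _ _ "M \<union> M'"] justified_mono[of A M' _ _ _ "M \<union> M'"]
  by (intro derivationI) (blast dest: derivation_triple)

lemma derivation_UN:
  assumes "\<And>i. i \<in> I \<Longrightarrow> derivation A (M i)"
  shows "derivation A (\<Union>i\<in>I. M i)"
proof (rule derivationI)
  fix e x y assume "triple e x y \<in> (\<Union>i\<in>I. M i)"
  then obtain i where i: "i \<in> I" "triple e x y \<in> M i" by blast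
  show "justified A (\<Union>i\<in>I. M i) e x y"
    by (rule justified_mono[OF derivation_triple[OF assms[OF i(1)] i(2)]]) (use i in blast)
qed

lemma derivation_insert:
  assumes "derivation A M" "justified A M e x y"
  shows "derivation A (insert (triple e x y) M)"
proof (rule derivationI)
  fix e' x' y' assume "triple e' x' y' \<in> insert (triple e x y) M"
  then have "justified A M e' x' y'"
    using assms derivation_triple by (auto simp: triple_eq)
  then show "justified A (insert (triple e x y) M) e' x' y'"
    by (rule justified_mono) blast
qed

lemma index_compound:
  assumes "5 \<le> e"
  obtains d m :: nat where "d < 4" "m < e" "prog_of e = compound_prog d m"
    "\<And>A M x y. justified A M e x y \<longleftrightarrow> compound_justified M e d m x y"
proof
  let ?d = "(e - 5) mod 4" and ?m = "(e - 5) div 4"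
  have ne: "e \<noteq> 0" "e \<noteq> 1" "e \<noteq> 2" "e \<noteq> 3" "e \<noteq> 4" using assms by auto
  show "?d < 4" by simp
  show "?m < e" using assms div_le_dividend[of "e - 5" 4] by linarith
  show "prog_of e = compound_prog ?d ?m"
    by (subst prog_of.simps) (simp only: compound_prog_def Let_def ne if_False)
  show "justified A M e x y \<longleftrightarrow> compound_justified M e ?d ?m x y" for A M x y
    by (simp only: justified_def ne if_False)
qed

lemma derivation_sound:
  assumes D: "derivation A M"
  shows "triple e x y \<in> M \<Longrightarrow> run A (prog_of e) x = Some y"
proof (induction e arbitrary: x y rule: less_induct)
  case (less e)
  have j: "justified A M e x y" using D less.prems by (rule derivation_triple)
  consider "e = 0" | "e = 1" | "e = 2" | "e = 3" | "e = 4" | "5 \<le> e" by linarith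
  then show ?case
  proof cases
    case 6
    from index_compound[OF 6] obtain d m :: nat where dm: "d < 4" "m < e"
      and compound: "prog_of e = compound_prog d m"
        "\<And>A M x y. justified A M e x y \<longleftrightarrow> compound_justified M e d m x y"
      by blast
    note prog = compound(1)[unfolded compound_prog_def]
      and just = compound(2)[unfolded compound_justified_def]
    let ?i = "fst (prod_decode m)" and ?j = "snd (prod_decode m)"
    have lt: "?i < e" "?j < e"
      using dm(2) fst_prod_decode_le[of m] snd_prod_decode_le[of m] by simp_all
    consider "d = 0" | "d = 1" | "d = 2" | "d = 3" using dm(1) by linarith
    then show ?thesis
    proof cases
      case 1
      then have "triple ?i x (fst (prod_decode y)) \<in> M" "triple ?j x (snd (prod_decode y)) \<in> M"
        using j just by simp_all
      from less.IH[OF lt(1) this(1)] less.IH[OF lt(2) this(2)] show ?thesis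
        using 1 prog by simp
    next
      case 2
      then obtain a where "triple ?j x a \<in> M" "triple ?i a y \<in> M"
        using j just by auto
      from less.IH[OF lt(2) this(1)] less.IH[OF lt(1) this(2)] show ?thesis
        using 2 prog by simp
    next
      case 3
      \<comment> \<open>A primitive recursion is justified by a claim with the same index, so the
        induction on the index needs an inner one on the recursion argument.\<close>
      have "triple e (prod_encode (a, n)) y \<in> M \<Longrightarrow> run A (prog_of e) (prod_encode (a, n)) = Some y" for a n y
      proof (induction n arbitrary: y)
        case 0
        have "triple ?i a y \<in> M"
          using derivation_triple[OF D 0] 3 unfolding just by simp
        from less.IH[OF lt(1) this] show ?case using 3 prog by simp
      next
        case (Suc n)
        obtain v where "triple e (prod_encode (a, n)) v \<in> M"
          "triple ?j (prod_encode (a, prod_encode (n, v))) y \<in> M"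
          using derivation_triple[OF D Suc.prems] 3 unfolding just by auto
        from Suc.IH[OF this(1)] less.IH[OF lt(2) this(2)] show ?case using 3 prog by simp
      qed
      from this[of "fst (prod_decode x)" "snd (prod_decode x)"] less.prems show ?thesis by simp
    next
      case 4
      then have y: "triple m (prod_encode (x, y)) 0 \<in> M"
        and z: "\<forall>z<y. \<exists>v. triple m (prod_encode (x, z)) (Suc v) \<in> M"
        using j just by simp_all
      have y: "run A (prog_of m) (prod_encode (x, y)) = Some 0" by (rule less.IH[OF dm(2) y])
      have z: "\<exists>v. run A (prog_of m) (prod_encode (x, z)) = Some (Suc v)" if "z < y" for z
        using z that less.IH[OF dm(2)] by blast
      have "\<exists>n. run A (prog_of m) (prod_encode (x, n)) = Some 0 \<and>
             (\<forall>k<n. run A (prog_of m) (prod_encode (x, k)) \<noteq> None)"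
        using y z by (intro exI[of _ y]) auto
      moreover have "(LEAST n. run A (prog_of m) (prod_encode (x, n)) = Some 0) = y"
      proof (rule Least_equality)
        show "y \<le> n" if "run A (prog_of m) (prod_encode (x, n)) = Some 0" for n
          using z[of n] that by (cases "n < y") auto
      qed (rule y)
      ultimately show ?thesis using 4 prog by simp
    qed
  qed (use j in \<open>simp_all add: justified_def prog_of.simps\<close>)
qed

text \<open>A converging computation has finitely many immediate subcomputations. The union of their
  derivations justifies the final claim, which is then inserted.\<close>

lemma derivation_complete:
  "run A (prog_of e) x = Some y \<Longrightarrow> \<exists>M. finite M \<and> derivation A M \<and> triple e x y \<in> M"
proof (induction e arbitrary: x y rule: less_induct)
  case (less e)
  have insert: ?case if "finite M" "derivation A M" "justified A M e x y" for M
    using derivation_insert[OF that(2,3)] that(1) by (intro exI[of _ "insert (triple e x y) M"]) simp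
  have empty: "derivation A {}" by (simp add: derivation_def)
  consider "e = 0" | "e = 1" | "e = 2" | "e = 3" | "e = 4" | "5 \<le> e" by linarith
  then show ?case
  proof cases
    case 6
    from index_compound[OF 6] obtain d m :: nat where dm: "d < 4" "m < e"
      and compound: "prog_of e = compound_prog d m"
        "\<And>A M x y. justified A M e x y \<longleftrightarrow> compound_justified M e d m x y"
      by blast
    note prog = compound(1)[unfolded compound_prog_def]
      and just = compound(2)[unfolded compound_justified_def]
    let ?i = "fst (prod_decode m)" and ?j = "snd (prod_decode m)"
    have lt: "?i < e" "?j < e"
      using dm(2) fst_prod_decode_le[of m] snd_prod_decode_le[of m] by simp_all
    consider "d = 0" | "d = 1" | "d = 2" | "d = 3" using dm(1) by linarith
    then show ?thesis
    proof cases
      case 1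
      then obtain a b where ab: "run A (prog_of ?i) x = Some a" "run A (prog_of ?j) x = Some b"
        "y = prod_encode (a, b)"
        using less.prems prog by (auto simp: Option.bind_eq_Some_conv)
      obtain M N where "finite M" "derivation A M" "triple ?i x a \<in> M"
        "finite N" "derivation A N" "triple ?j x b \<in> N"
        using less.IH[OF lt(1) ab(1)] less.IH[OF lt(2) ab(2)] by blast
      then show ?thesis
        using 1 ab(3) derivation_Un[of A M N] by (intro insert[of "M \<union> N"]) (auto simp: just)
    next
      case 2
      then obtain a where a: "run A (prog_of ?j) x = Some a" "run A (prog_of ?i) a = Some y"
        using less.prems prog by (auto simp: Option.bind_eq_Some_conv)
      obtain M N where "finite M" "derivation A M" "triple ?j x a \<in> M"
        "finite N" "derivation A N" "triple ?i a y \<in> N"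
        using less.IH[OF lt(2) a(1)] less.IH[OF lt(1) a(2)] by blast
      then show ?thesis
        using 2 derivation_Un[of A M N] by (intro insert[of "M \<union> N"]) (auto simp: just)
    next
      case 3
      have "\<exists>M. finite M \<and> derivation A M \<and> triple e (prod_encode (a, n)) y \<in> M"
        if "run A (prog_of e) (prod_encode (a, n)) = Some y" for a n y
        using that
      proof (induction n arbitrary: y)
        case 0
        then have "run A (prog_of ?i) a = Some y" using 3 prog by simp
        from less.IH[OF lt(1) this] obtain M where "finite M" "derivation A M" "triple ?i a y \<in> M"
          by blast
        then show ?case
          using derivation_insert[of A M e "prod_encode (a, 0)" y] 3
          by (intro exI[of _ "insert (triple e (prod_encode (a, 0)) y) M"]) (simp add: just)
      next
        case (Suc n)
        then obtain v where v: "run A (prog_of e) (prod_encode (a, n)) = Some v"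
          "run A (prog_of ?j) (prod_encode (a, prod_encode (n, v))) = Some y"
          using 3 prog by (auto simp: Option.bind_eq_Some_conv)
        obtain M N where "finite M" "derivation A M" "triple e (prod_encode (a, n)) v \<in> M"
          "finite N" "derivation A N" "triple ?j (prod_encode (a, prod_encode (n, v))) y \<in> N"
          using Suc.IH[OF v(1)] less.IH[OF lt(2) v(2)] by blast
        then show ?case
          using derivation_Un[of A M N] derivation_insert[of A "M \<union> N" e "prod_encode (a, Suc n)" y] 3
          by (intro exI[of _ "insert (triple e (prod_encode (a, Suc n)) y) (M \<union> N)"]) (auto simp: just)
      qed
      from this[of "fst (prod_decode x)" "snd (prod_decode x)" y] less.prems show ?thesis by simp
    next
      case 4
      let ?r = "\<lambda>n. run A (prog_of m) (prod_encode (x, n))"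
      have "run A (prog_of e) x = (if \<exists>n. ?r n = Some 0 \<and> (\<forall>k<n. ?r k \<noteq> None) then Some (LEAST n. ?r n = Some 0) else None)"
        using 4 prog by simp
      then have ex: "\<exists>n. ?r n = Some 0 \<and> (\<forall>k<n. ?r k \<noteq> None)" and y: "y = (LEAST n. ?r n = Some 0)"
        using less.prems by (auto split: if_splits)
      obtain n where n: "?r n = Some 0" "\<forall>k<n. ?r k \<noteq> None" using ex by blast
      have y0: "?r y = Some 0" unfolding y by (rule LeastI[of "\<lambda>n. ?r n = Some 0", OF n(1)])
      have "y \<le> n" unfolding y by (rule Least_le[of "\<lambda>n. ?r n = Some 0", OF n(1)])
      \<comment> \<open>Everything up to \<open>y\<close> converges because \<open>y\<close> is at
        most the zero \<open>n\<close> found by the search; by minimality, the value is zero only at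
        \<open>y\<close>.\<close>
      have val: "\<exists>v. ?r z = Some v \<and> (v = 0 \<longleftrightarrow> z = y)" if "z \<le> y" for z
      proof (cases "z = y")
        case False
        then have "z < y" using that by simp
        then have "?r z \<noteq> Some 0" unfolding y by (rule not_less_Least)
        moreover have "?r z \<noteq> None" using n(2) \<open>z < y\<close> \<open>y \<le> n\<close> by simp
        ultimately show ?thesis using False by auto
      qed (use y0 in simp)
      have "\<forall>z\<in>{..y}. \<exists>M v. finite M \<and> derivation A M \<and> triple m (prod_encode (x, z)) v \<in> M \<and> (v = 0 \<longleftrightarrow> z = y)"
        using val less.IH[OF dm(2)] by (metis atMost_iff)
      then obtain M v where M: "\<And>z. z \<le> y \<Longrightarrow> finite (M z)" "\<And>z. z \<in> {..y} \<Longrightarrow> derivation A (M z)"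
        and t: "\<And>z. z \<le> y \<Longrightarrow> triple m (prod_encode (x, z)) (v z) \<in> M z"
        and v: "\<And>z. z \<le> y \<Longrightarrow> v z = 0 \<longleftrightarrow> z = y"
        unfolding bchoice_iff by (metis atMost_iff)
      show ?thesis
      proof (rule insert[of "\<Union>z\<in>{..y}. M z"])
        show "finite (\<Union>z\<in>{..y}. M z)" using M(1) by simp
        show "derivation A (\<Union>z\<in>{..y}. M z)" using M(2) by (rule derivation_UN)
        have "triple m (prod_encode (x, y)) 0 \<in> (\<Union>z\<in>{..y}. M z)"
          using t[of y] v[of y] by auto
        moreover have "\<exists>w. triple m (prod_encode (x, z)) (Suc w) \<in> (\<Union>z\<in>{..y}. M z)" if z: "z < y" for z
        proof -
          obtain w where "v z = Suc w" using v[of z] z by (cases "v z") auto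
          then have "triple m (prod_encode (x, z)) (Suc w) \<in> M z" using t[of z] z by simp
          then show ?thesis using z by (intro exI[of _ w] UN_I[of z]) simp_all
        qed
        ultimately show "justified A (\<Union>z\<in>{..y}. M z) e x y" using 4 unfolding just by simp
      qed
    qed
  qed (use less.prems insert[OF _ empty] in \<open>simp_all add: justified_def prog_of.simps\<close>)
qed

section \<open>Halting witnessed by coded finite derivations\<close>

definition halts :: "nat \<Rightarrow> nat \<Rightarrow> nat set \<Rightarrow> bool" where
  "halts e S A \<longleftrightarrow> derivation A (set_decode S) \<and> (\<exists>y. triple e e y \<in> set_decode S)"

lemma turing_jump_iff: "e \<in> turing_jump A \<longleftrightarrow> (\<exists>S. halts e S A)"
proof
  assume "e \<in> turing_jump A"
  then obtain y where "run A (prog_of e) e = Some y" unfolding turing_jump_def by blast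
  from derivation_complete[OF this] obtain M where "finite M" "derivation A M" "triple e e y \<in> M" by blast
  then show "\<exists>S. halts e S A"
    unfolding halts_def by (metis set_encode_inverse)
next
  assume "\<exists>S. halts e S A"
  then show "e \<in> turing_jump A"
    unfolding halts_def turing_jump_def using derivation_sound by blast
qed

text \<open>All numbers mentioned in the derivation coded by \<open>S\<close> are below
  \<open>S\<close>, so the oracle is consulted only there: \<open>S\<close> bounds the use of the
  computation.\<close>

lemma halts_cong:
  assumes "halts e S A" "A \<inter> {..<S} = B \<inter> {..<S}"
  shows "halts e S B"
proof -
  have "justified B (set_decode S) e x y" if j: "justified A (set_decode S) e x y"
    and t: "triple e x y \<in> set_decode S" for e x y
  proof -
    have x: "x \<in> A \<longleftrightarrow> x \<in> B" using assms(2) triple_less[OF t] by blast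
    show ?thesis using j unfolding justified_def x .
  qed
  then show ?thesis
    using assms(1) unfolding halts_def by (meson derivationI derivation_triple)
qed

lemma computable_in_triple [computable]:
  assumes "computable_in A f" "computable_in A g" "computable_in A h"
  shows "computable_in A (\<lambda>x. triple (f x) (g x) (h x))"
  unfolding triple_def by (intro computable assms)

text \<open>These equivalences bound the existential quantifiers in
  \<open>compound_justified\<close> and \<open>halts\<close>, so that checking a coded derivation is
  decidable.\<close>

lemma ex_triple_bound:
  "(\<exists>v. triple a b v \<in> set_decode S \<and> P v) \<longleftrightarrow> (\<exists>v<S. triple a b v \<in> set_decode S \<and> P v)"
  "(\<exists>v. triple a b v \<in> set_decode S) \<longleftrightarrow> (\<exists>v<S. triple a b v \<in> set_decode S)"
  "(\<exists>v. triple a b (Suc v) \<in> set_decode S) \<longleftrightarrow> (\<exists>v<S. triple a b (Suc v) \<in> set_decode S)"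
  by (meson triple_less Suc_lessD)+

lemma decidable_in_halts:
  assumes "computable_in A e" "computable_in A S" "computable_in A F" "computable_in A E"
  shows "decidable_in A (\<lambda>x. halts (e x) (S x) (set_decode (F x) \<union> set_decode (E x)))"
  unfolding halts_def derivation_def justified_def compound_justified_def ex_triple_bound Un_iff
  by (intro computable assms assms[THEN computable_in_comp])

text \<open>Compactness of Cantor space. An initial segment is good if it is extended by solutions
  at every level. If both one-bit extensions of a good segment failed, at levels \<open>M1\<close>
  and \<open>M2\<close>, then a solution at level \<open>max M1 M2\<close> would contradict one of
  the failures; so good segments form an infinite branch.\<close>

lemma koenig_sets:
  fixes P :: "nat \<Rightarrow> nat set \<Rightarrow> bool"
  assumes ex: "\<And>N. \<exists>X. P N X"
    and mono: "\<And>M N X. M \<le> N \<Longrightarrow> P N X \<Longrightarrow> P M X"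
    and cong: "\<And>N X Y. X \<inter> {..<N} = Y \<inter> {..<N} \<Longrightarrow> P N X \<Longrightarrow> P N Y"
  shows "\<exists>X. \<forall>N. P N X"
proof -
  define good where "good N X \<longleftrightarrow> (\<forall>M. \<exists>Y. P M Y \<and> Y \<inter> {..<N} = X \<inter> {..<N})" for N X
  have good_step: "\<exists>Y. good (Suc N) Y \<and> Y \<inter> {..<N} = X \<inter> {..<N}" if "good N X" for N X
  proof (rule ccontr)
    assume contr: "\<not> ?thesis"
    have "insert N X \<inter> {..<N} = X \<inter> {..<N}" "(X - {N}) \<inter> {..<N} = X \<inter> {..<N}" by auto
    then have "\<not> good (Suc N) (insert N X)" "\<not> good (Suc N) (X - {N})" using contr by blast+
    then obtain M1 M2 where
      M1: "\<And>Y. P M1 Y \<Longrightarrow> Y \<inter> {..<Suc N} \<noteq> insert N X \<inter> {..<Suc N}" and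
      M2: "\<And>Y. P M2 Y \<Longrightarrow> Y \<inter> {..<Suc N} \<noteq> (X - {N}) \<inter> {..<Suc N}"
      unfolding good_def by blast
    obtain Y where Y: "P (max M1 M2) Y" "Y \<inter> {..<N} = X \<inter> {..<N}"
      using \<open>good N X\<close> unfolding good_def by blast
    have P12: "P M1 Y" "P M2 Y" using mono[OF _ Y(1)] by simp_all
    show False
    proof (cases "N \<in> Y")
      case True
      then have "Y \<inter> {..<Suc N} = insert N X \<inter> {..<Suc N}"
        using Y(2) by (auto simp: lessThan_Suc)
      then show False using M1[OF P12(1)] by contradiction
    next
      case False
      then have "Y \<inter> {..<Suc N} = (X - {N}) \<inter> {..<Suc N}"
        using Y(2) by (auto simp: lessThan_Suc)
      then show False using M2[OF P12(2)] by contradiction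
    qed
  qed
  have "good 0 {}" using ex by (simp add: good_def)
  have "\<exists>G. \<forall>N. good N (G N) \<and> G (Suc N) \<inter> {..<N} = G N \<inter> {..<N}"
  proof (rule dependent_nat_choice)
    show "\<exists>X. good 0 X" using \<open>good 0 {}\<close> ..
  qed (rule good_step)
  then obtain G where G: "\<And>N. good N (G N)" "\<And>N. G (Suc N) \<inter> {..<N} = G N \<inter> {..<N}"
    by meson
  have stable: "x \<in> G N \<longleftrightarrow> x \<in> G (Suc x)" if "x < N" for x N
    using that
  proof (induction N)
    case (Suc N)
    show ?case
    proof (cases "x = N")
      case False
      then have "x < N" using Suc.prems by simp
      then show ?thesis using Suc.IH G(2)[of N] by blast
    qed simp
  qed simp
  \<comment> \<open>The bit at \<open>x\<close> is fixed from stage \<open>Suc x\<close> on, so it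
    is read there.\<close>
  define X where "X = {x. x \<in> G (Suc x)}"
  have "P N X" for N
  proof -
    obtain Y where "P N Y" "Y \<inter> {..<N} = G N \<inter> {..<N}" using G(1) unfolding good_def by blast
    moreover have "G N \<inter> {..<N} = X \<inter> {..<N}" using stable unfolding X_def by blast
    ultimately show ?thesis using cong by metis
  qed
  then show ?thesis by blast
qed

lemma prod_encode_mono: "a \<le> a' \<Longrightarrow> b \<le> b' \<Longrightarrow> prod_encode (a, b) \<le> prod_encode (a', b')"
  unfolding prod_encode_def triangle_def by (auto intro!: add_mono div_le_mono mult_mono)

section \<open>Avoiding halting computations\<close>

text \<open>Every set \<open>Y\<close> of pairs is closed up to a monotone notion of largeness, so that the possible
  notions of largeness form the compact space of all sets.\<close>

definition large :: "nat set \<Rightarrow> nat \<Rightarrow> nat \<Rightarrow> bool" where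
  "large Y x z \<longleftrightarrow> (\<exists>x'<Suc z. \<exists>z'<Suc z. x \<le> x' \<and> x' \<le> z' \<and> prod_encode (x', z') \<in> Y)"

definition transitive_for :: "nat set \<Rightarrow> nat set \<Rightarrow> bool" where
  "transitive_for Y E \<longleftrightarrow>
    (\<forall>x\<in>E. \<forall>y\<in>E. \<forall>z\<in>E. x < y \<and> y < z \<and> \<not> large Y x y \<and> \<not> large Y y z \<longrightarrow> \<not> large Y x z)"

definition column :: "nat set \<Rightarrow> nat \<Rightarrow> nat set" where
  "column X i = {m. prod_encode (i, m) \<in> X}"

lemma large_mono: "large Y x z \<Longrightarrow> x' \<le> x \<Longrightarrow> z \<le> z' \<Longrightarrow> large Y x' z'"
  unfolding large_def by (meson Suc_le_mono le_trans less_le_trans)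

text \<open>The columns \<open>i < s\<close> of \<open>X\<close> are promises: as long as the stem \<open>F\<close> is extended by sets
  transitive for all of them, no \<open>e \<in> Z\<close> can enter the jump.\<close>

definition avoids :: "nat \<Rightarrow> nat set \<Rightarrow> nat \<Rightarrow> nat set \<Rightarrow> nat set \<Rightarrow> bool" where
  "avoids s F n Z X \<longleftrightarrow>
    (\<forall>E. finite E \<longrightarrow> (\<forall>x\<in>E. n \<le> x) \<longrightarrow> (\<forall>i<s. transitive_for (column X i) E) \<longrightarrow>
      (\<forall>e\<in>Z. \<forall>S. \<not> halts e S (F \<union> E)))"

text \<open>A finite approximation to \<open>avoids\<close>. Testing whether the columns
  \<open>i < s\<close> make the set coded by \<open>E\<close> transitive only consults bits of
  \<open>X\<close> below \<open>triple s E E\<close>, so the guard on that number makes the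
  approximation depend on \<open>X\<close> below \<open>N\<close> alone.\<close>

definition avoids_upto :: "nat \<Rightarrow> nat set \<Rightarrow> nat \<Rightarrow> nat set \<Rightarrow> nat \<Rightarrow> nat set \<Rightarrow> bool" where
  "avoids_upto s F n Z N X \<longleftrightarrow>
    (\<forall>E<N. \<forall>S<N. triple s E E < N \<longrightarrow> (\<forall>x\<in>set_decode E. n \<le> x) \<longrightarrow>
      (\<forall>i<s. transitive_for (column X i) (set_decode E)) \<longrightarrow>
      (\<forall>e\<in>Z. \<not> halts e S (F \<union> set_decode E)))"

lemma avoids_iff: "avoids s F n Z X \<longleftrightarrow> (\<forall>N. avoids_upto s F n Z N X)"
proof
  assume "avoids s F n Z X"
  then show "\<forall>N. avoids_upto s F n Z N X"
    unfolding avoids_def avoids_upto_def using finite_set_decode by blast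
next
  assume *: "\<forall>N. avoids_upto s F n Z N X"
  show "avoids s F n Z X"
    unfolding avoids_def
  proof (intro allI impI ballI)
    fix E e S
    assume E: "finite E" "\<forall>x\<in>E. n \<le> x" "\<forall>i<s. transitive_for (column X i) E" and e: "e \<in> Z"
    define d where "d = set_encode E"
    have d: "set_decode d = E" using E(1) by (simp add: d_def set_encode_inverse)
    have "d < Suc (d + S + triple s d d)" "S < Suc (d + S + triple s d d)"
      "triple s d d < Suc (d + S + triple s d d)" by simp_all
    then show "\<not> halts e S (F \<union> E)"
      using * E e d unfolding avoids_upto_def by metis
  qed
qed

lemma avoids_upto_cong:
  assumes XY: "X \<inter> {..<N} = Y \<inter> {..<N}" and "avoids_upto s F n Z N X"
  shows "avoids_upto s F n Z N Y"
proof -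
  have "transitive_for (column X i) (set_decode E) \<longleftrightarrow> transitive_for (column Y i) (set_decode E)"
    if N: "triple s E E < N" and i: "i < s" for E i
  proof -
    have "large (column X i) x z \<longleftrightarrow> large (column Y i) x z" if "z \<in> set_decode E" for x z
    proof -
      have "prod_encode (x', z') \<in> column X i \<longleftrightarrow> prod_encode (x', z') \<in> column Y i"
        if "x' < Suc z" "z' < Suc z" for x' z'
      proof -
        have "z < E" using \<open>z \<in> set_decode E\<close> by (rule set_decode_less)
        then have "prod_encode (i, prod_encode (x', z')) < N"
          using that i by (intro le_less_trans[OF _ N[unfolded triple_def]] prod_encode_mono) auto
        then show ?thesis using XY unfolding column_def by blast
      qed
      then show ?thesis unfolding large_def by blast
    qed
    then show ?thesis unfolding transitive_for_def by blast
  qed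
  then show ?thesis using assms(2) unfolding avoids_upto_def by blast
qed

text \<open>Compactness replaces the quantifier over sets by one universal number quantifier: at
  level \<open>N\<close> only the part of \<open>X\<close> below \<open>N\<close> matters, and it
  has a code below \<open>2 ^ N\<close>.\<close>

lemma ex_avoids_iff:
  "(\<exists>X. avoids s F n Z X) \<longleftrightarrow> (\<forall>N. \<exists>D<2 ^ N. avoids_upto s F n Z N (set_decode D))"
proof
  assume "\<exists>X. avoids s F n Z X"
  then obtain X where X: "\<And>N. avoids_upto s F n Z N X" unfolding avoids_iff by blast
  show "\<forall>N. \<exists>D<2 ^ N. avoids_upto s F n Z N (set_decode D)"
  proof
    fix N
    let ?D = "set_encode (X \<inter> {..<N})"
    have fin: "finite (X \<inter> {..<N})" by simp
    have "?D \<le> set_encode {..<N}"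
      unfolding set_encode_def by (rule sum_mono2) auto
    also have "\<dots> = 2 ^ N - 1"
      using sum_power2[of N] by (simp add: set_encode_def atLeast0LessThan)
    finally have "?D < 2 ^ N"
      by (simp add: Suc_le_eq[symmetric] le_diff_conv2 Suc_leI)
    moreover have "avoids_upto s F n Z N (set_decode ?D)"
      using X[of N] by (rule avoids_upto_cong[rotated]) (simp add: set_encode_inverse[OF fin])
    ultimately show "\<exists>D<2 ^ N. avoids_upto s F n Z N (set_decode D)" by blast
  qed
next
  assume ex: "\<forall>N. \<exists>D<2 ^ N. avoids_upto s F n Z N (set_decode D)"
  have "\<exists>X. \<forall>N. avoids_upto s F n Z N X"
  proof (rule koenig_sets)
    show "\<exists>X. avoids_upto s F n Z N X" for N using ex by blast
    show "avoids_upto s F n Z M X" if "M \<le> N" "avoids_upto s F n Z N X" for M N X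
      using that unfolding avoids_upto_def by (meson less_le_trans)
  qed (rule avoids_upto_cong)
  then show "\<exists>X. avoids s F n Z X" unfolding avoids_iff .
qed

text \<open>A column that is nowhere large above \<open>n1\<close> makes all sets above
  \<open>n1\<close> transitive. For the other columns the tail starts so late that every interval
  from \<open>E0\<close> into it is large; two consecutive small intervals then lie on one
  side.\<close>

lemma transitive_for_Un_tail:
  assumes fin: "finite E0"
    and lim: "\<And>i. i < s \<Longrightarrow> (\<forall>z. \<not> large (column X i) n1 z) \<or> (\<forall>x. \<exists>z. large (column X i) x z)"
    and E0: "\<And>x. x \<in> E0 \<Longrightarrow> n1 \<le> x" "\<And>i. i < s \<Longrightarrow> transitive_for (column X i) E0"
  obtains n2 where "m \<le> n2" "\<And>x. x \<in> E0 \<Longrightarrow> x < n2"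
    "\<And>E i. i < s \<Longrightarrow> \<forall>x\<in>E. n2 \<le> x \<Longrightarrow> transitive_for (column X i) E \<Longrightarrow> transitive_for (column X i) (E0 \<union> E)"
proof -
  define b where "b i x = (SOME z. large (column X i) x z)" for i x
  \<comment> \<open>The first sum puts \<open>n2\<close> above \<open>E0\<close>, the second above a
    point where each column has become large from each member of \<open>E0\<close>. For nowhere
    large columns the chosen \<open>b i x\<close> is arbitrary and harmless.\<close>
  define n2 where "n2 = n1 + m + (\<Sum>x\<in>E0. Suc x) + (\<Sum>x\<in>E0. \<Sum>i<s. b i x)"
  have lt: "x < n2" if "x \<in> E0" for x
    using member_le_sum[OF that, of Suc] fin unfolding n2_def by fastforce
  have bn2: "b i x \<le> n2" if "i < s" "x \<in> E0" for i x
  proof -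
    have "b i x \<le> (\<Sum>i<s. b i x)" using that(1) by (intro member_le_sum) auto
    also have "\<dots> \<le> (\<Sum>x\<in>E0. \<Sum>i<s. b i x)" using that(2) fin by (intro member_le_sum) auto
    finally show ?thesis unfolding n2_def by simp
  qed
  show thesis
  proof (rule that)
    show "m \<le> n2" by (simp add: n2_def)
    fix E i
    assume i: "i < s" and E: "\<forall>x\<in>E. n2 \<le> x" "transitive_for (column X i) E"
    show "transitive_for (column X i) (E0 \<union> E)"
    proof (cases "\<forall>z. \<not> large (column X i) n1 z")
      case True
      have "\<not> large (column X i) x z" if "x \<in> E0 \<union> E" for x z
      proof -
        have "n1 \<le> n2" by (simp add: n2_def)
        then have "n1 \<le> x" using that E0(1) E(1) le_trans by blast
        then show ?thesis using True large_mono by blast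
      qed
      then show ?thesis unfolding transitive_for_def by blast
    next
      case False
      then have fin: "\<exists>z. large (column X i) x z" for x using lim[OF i] by blast
      have large: "large (column X i) x z" if "x \<in> E0" "z \<in> E" for x z
      proof -
        have "large (column X i) x (b i x)" unfolding b_def using fin by (rule someI_ex)
        moreover have "b i x \<le> z" using bn2[OF i that(1)] E(1) that(2) by (meson le_trans)
        ultimately show ?thesis by (rule large_mono[OF _ order_refl])
      qed
      have less: "x < z" if "x \<in> E0" "z \<in> E" for x z using lt E(1) that by (meson less_le_trans)
      show ?thesis
        unfolding transitive_for_def
      proof (intro ballI impI)
        fix x y z
        assume xyz: "x \<in> E0 \<union> E" "y \<in> E0 \<union> E" "z \<in> E0 \<union> E"
          and h: "x < y \<and> y < z \<and> \<not> large (column X i) x y \<and> \<not> large (column X i) y z"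
        have "x \<in> E0 \<and> y \<in> E0 \<and> z \<in> E0 \<or> x \<in> E \<and> y \<in> E \<and> z \<in> E"
          using xyz h large less by (metis UnE less_asym)
        then show "\<not> large (column X i) x z"
          using h E(2) E0(2)[OF i] unfolding transitive_for_def by blast
      qed
    qed
  qed (rule lt)
qed

section \<open>Conditions and their extensions\<close>

abbreviation stem :: "nat \<Rightarrow> nat set" where
  "stem c \<equiv> set_decode (fst (prod_decode c))"

abbreviation bound :: "nat \<Rightarrow> nat" where
  "bound c \<equiv> fst (prod_decode (snd (prod_decode c)))"

abbreviation diverging :: "nat \<Rightarrow> nat set" where
  "diverging c \<equiv> set_decode (snd (prod_decode (snd (prod_decode c))))"

definition valid :: "(nat \<Rightarrow> nat) \<Rightarrow> nat \<Rightarrow> nat \<Rightarrow> bool" where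
  "valid g s c \<longleftrightarrow> (\<exists>X. avoids s (stem c) (bound c) (diverging c) X) \<and> g_transitive g (stem c) \<and>
    (\<forall>x\<in>stem c. x < bound c \<and> g x \<le> bound c)"

text \<open>New elements lie above the old bound, and at least one is added, so the union of the
  stems is infinite. The requirement \<open>S < bound c'\<close> protects the computation found for
  \<open>s\<close>: its use lies below the bound that later elements respect.\<close>

definition extends :: "nat \<Rightarrow> nat \<Rightarrow> nat \<Rightarrow> bool" where
  "extends s c c' \<longleftrightarrow>
    (\<forall>x\<in>stem c. x \<in> stem c') \<and> (\<forall>x\<in>stem c'. x \<in> stem c \<or> bound c \<le> x) \<and>
    (\<exists>x\<in>stem c'. bound c \<le> x) \<and> (\<forall>e\<in>diverging c. e \<in> diverging c') \<and>
    (s \<in> diverging c' \<or> (\<exists>S<bound c'. halts s S (stem c')))"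

lemma valid_zero: "valid g 0 0"
proof -
  have "prod_decode 0 = (0, 0)"
    by (metis le_prod_encode_1 le_prod_encode_2 le_zero_eq prod.collapse prod_decode_inverse)
  then show ?thesis by (simp add: valid_def avoids_def g_transitive_def)
qed

text \<open>Every interval from \<open>F\<close> into \<open>E\<close> is \<open>g\<close>-large, so
  consecutive small intervals cannot cross from one part to the other.\<close>

lemma g_transitive_Un:
  assumes "g_transitive g F" "g_transitive g E"
    and "\<And>x. x \<in> F \<Longrightarrow> x < n \<and> g x \<le> n" "\<And>x. x \<in> E \<Longrightarrow> n \<le> x"
  shows "g_transitive g (F \<union> E)"
  unfolding g_transitive_def
proof (intro ballI impI)
  fix x y z
  assume xyz: "x \<in> F \<union> E" "y \<in> F \<union> E" "z \<in> F \<union> E"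
    and h: "x < y \<and> y < z \<and> g_small g x y \<and> g_small g y z"
  have large: "\<not> g_small g x z" and less: "x < z" if "x \<in> F" "z \<in> E" for x z
    using assms(3)[OF that(1)] assms(4)[OF that(2)] by (auto simp: g_small_def g_large_def)
  have "x \<in> F \<and> y \<in> F \<and> z \<in> F \<or> x \<in> E \<and> y \<in> E \<and> z \<in> E"
    using xyz h large less by (metis UnE less_asym)
  then show "g_small g x z"
    using h assms(1,2) unfolding g_transitive_def by blast
qed

text \<open>For monotone \<open>g\<close> the closure built into \<open>large\<close> adds nothing:
  \<open>x \<le> x'\<close> and \<open>g x' \<le> z' \<le> z\<close> already give
  \<open>g x \<le> z\<close>.\<close>

lemma large_graph:
  assumes "mono g" "x \<le> z"
  shows "large {prod_encode (x, z) | x z. g x \<le> z} x z \<longleftrightarrow> g_large g x z"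
proof
  assume "large {prod_encode (x, z) | x z. g x \<le> z} x z"
  then obtain x' z' where "z' < Suc z" "x \<le> x'" "g x' \<le> z'"
    unfolding large_def by (auto simp: prod_encode_eq)
  then show "g_large g x z"
    using monoD[OF assms(1), of x x'] unfolding g_large_def by simp
next
  assume "g_large g x z"
  then show "large {prod_encode (x, z) | x z. g x \<le> z} x z"
    using assms(2) unfolding large_def g_large_def by (intro exI[of _ x] exI[of _ z] conjI) auto
qed

lemma transitive_for_graph:
  assumes "mono g"
  shows "transitive_for {prod_encode (x, z) | x z. g x \<le> z} E \<longleftrightarrow> g_transitive g E"
  unfolding transitive_for_def g_transitive_def g_small_def
  using large_graph[OF assms] by (meson less_imp_le order.strict_trans)

text \<open>A point from which nothing is large keeps this property when increased, so a sum of such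
  points serves all columns that have one.\<close>

lemma limit_index:
  obtains n1 where "n \<le> n1"
    "\<And>i. i < s \<Longrightarrow> (\<forall>z. \<not> large (column X i) n1 z) \<or> (\<forall>x. \<exists>z. large (column X i) x z)"
proof -
  define a where "a i = (SOME x. \<forall>z. \<not> large (column X i) x z)" for i
  define n1 where "n1 = n + (\<Sum>i<s. a i)"
  show thesis
  proof (rule that)
    show "n \<le> n1" by (simp add: n1_def)
    fix i assume i: "i < s"
    have "a i \<le> (\<Sum>i<s. a i)" using i by (intro member_le_sum) auto
    then have "a i \<le> n1" by (simp add: n1_def)
    moreover have "\<forall>z. \<not> large (column X i) (a i) z" if "\<exists>x. \<forall>z. \<not> large (column X i) x z"
      unfolding a_def using that by (rule someI_ex)
    ultimately show "(\<forall>z. \<not> large (column X i) n1 z) \<or> (\<forall>x. \<exists>z. large (column X i) x z)"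
      using large_mono by blast
  qed
qed

text \<open>One forcing step. The point \<open>n1\<close> is added first, so that the stem grows in
  either case; index \<open>s\<close> is then decided by extensions above \<open>n2\<close>.\<close>

lemma ex_extends:
  assumes g: "mono g" and c: "valid g s c"
  shows "\<exists>c'. extends s c c' \<and> valid g (Suc s) c'"
proof -
  let ?F = "stem c" and ?Z = "diverging c"
  obtain X where X: "avoids s ?F (bound c) ?Z X" using c unfolding valid_def by blast
  have F: "g_transitive g ?F" "\<And>x. x \<in> ?F \<Longrightarrow> x < bound c \<and> g x \<le> bound c"
    using c unfolding valid_def by blast+
  \<comment> \<open>Above \<open>n1\<close> every column is either nowhere large or large somewhere from each point. In both cases
    appending a tail beyond a sufficiently large bound preserves transitivity.\<close>
  obtain n1 where n1: "bound c \<le> n1"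
    and lim: "\<And>i. i < s \<Longrightarrow> (\<forall>z. \<not> large (column X i) n1 z) \<or> (\<forall>x. \<exists>z. large (column X i) x z)"
    using limit_index[of "bound c" s X] by blast
  \<comment> \<open>Appending \<open>E0\<close> with new bound \<open>n'\<close> keeps the promises
    and \<open>g\<close>-transitivity. The last conjunct lets a second block be appended after
    \<open>E0\<close>.\<close>
  define ext where "ext E0 n' \<longleftrightarrow> avoids s (?F \<union> E0) n' ?Z X \<and> g_transitive g (?F \<union> E0) \<and>
      (\<forall>x\<in>?F \<union> E0. x < n' \<and> g x \<le> n') \<and>
      (\<forall>E. (\<forall>x\<in>E. n' \<le> x) \<longrightarrow> (\<forall>i<s. transitive_for (column X i) E) \<longrightarrow>
        (\<forall>i<s. transitive_for (column X i) (E0 \<union> E)))" for E0 n'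
  have extend: "\<exists>n'\<ge>m. ext E0 n'"
    if E0: "finite E0" "\<And>x. x \<in> E0 \<Longrightarrow> n1 \<le> x" "\<And>i. i < s \<Longrightarrow> transitive_for (column X i) E0"
      "g_transitive g E0" for E0 m
  proof -
    have "\<exists>b. \<forall>x\<in>E0. g x \<le> b" using E0(1) by (metis finite_imageI finite_nat_set_iff_bounded_le imageI)
    then obtain b where b: "\<And>x. x \<in> E0 \<Longrightarrow> g x \<le> b" by blast
    from transitive_for_Un_tail[OF E0(1) lim E0(2,3), where m = "m + bound c + b"]
    obtain n' where n': "m + bound c + b \<le> n'" "\<And>x. x \<in> E0 \<Longrightarrow> x < n'"
      and tail: "\<And>E i. i < s \<Longrightarrow> \<forall>x\<in>E. n' \<le> x \<Longrightarrow> transitive_for (column X i) E \<Longrightarrow>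
        transitive_for (column X i) (E0 \<union> E)"
      by metis
    have "avoids s (?F \<union> E0) n' ?Z X"
      unfolding avoids_def
    proof (intro allI impI)
      fix E
      assume E: "finite E" "\<forall>x\<in>E. n' \<le> x" "\<forall>i<s. transitive_for (column X i) E"
      have "\<forall>x\<in>E0 \<union> E. bound c \<le> x" using E0(2) E(2) n1 n'(1) by fastforce
      moreover have "\<forall>i<s. transitive_for (column X i) (E0 \<union> E)" using tail E by blast
      ultimately show "\<forall>e\<in>?Z. \<forall>S. \<not> halts e S (?F \<union> E0 \<union> E)"
        using X E(1) E0(1) unfolding avoids_def by (metis finite_UnI sup_assoc)
    qed
    moreover have "g_transitive g (?F \<union> E0)"
      by (rule g_transitive_Un[OF F(1) E0(4) F(2)]) (use E0(2) n1 in fastforce)+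
    moreover have "x < n' \<and> g x \<le> n'" if "x \<in> ?F \<union> E0" for x
      using that F(2)[of x] b[of x] n'(1) n'(2)[of x] by fastforce
    ultimately have "ext E0 n'" unfolding ext_def using tail by blast
    moreover have "m \<le> n'" using n'(1) by simp
    ultimately show ?thesis by blast
  qed
  have code: "\<exists>c'. stem c' = F' \<and> bound c' = n' \<and> diverging c' = Z'"
    if "finite F'" "finite Z'" for F' n' Z'
    using that by (intro exI[of _ "prod_encode (set_encode F', prod_encode (n', set_encode Z'))"])
      (simp add: set_encode_inverse)
  have trans_singleton: "transitive_for Y {n1}" "g_transitive g {n1}" for Y
    by (simp_all add: transitive_for_def g_transitive_def)
  have "\<exists>n'\<ge>n1. ext {n1} n'"
    by (rule extend) (simp_all add: trans_singleton)
  then obtain n2 where n2: "n1 \<le> n2" and ext: "ext {n1} n2" by blast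
  have n2': "avoids s (?F \<union> {n1}) n2 ?Z X" "g_transitive g (?F \<union> {n1})"
    "\<forall>x\<in>?F \<union> {n1}. x < n2 \<and> g x \<le> n2"
    using ext unfolding ext_def by simp_all
  have tail: "transitive_for (column X i) ({n1} \<union> E)"
    if "\<forall>x\<in>E. n2 \<le> x" "\<forall>i<s. transitive_for (column X i) E" "i < s" for E i
    using ext that unfolding ext_def by blast
  define stuck where "stuck Y \<longleftrightarrow> (\<forall>E. finite E \<longrightarrow> (\<forall>x\<in>E. n2 \<le> x) \<longrightarrow>
      (\<forall>i<s. transitive_for (column X i) E) \<longrightarrow> transitive_for Y E \<longrightarrow>
      (\<forall>S. \<not> halts s S (?F \<union> {n1} \<union> E)))" for Y
  \<comment> \<open>Quantifying over all \<open>Y\<close> instead of asking about \<open>g\<close> keeps the question simple: a negative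
    answer yields a new column, and a positive one is applied to the graph of \<open>g\<close>.\<close>
  show ?thesis
  proof (cases "\<exists>Y. stuck Y")
    case True
    then obtain Y where "stuck Y" by blast
    then have Y: "\<not> halts s S (?F \<union> {n1} \<union> E)"
      if "finite E" "\<forall>x\<in>E. n2 \<le> x" "\<forall>i<s. transitive_for (column X i) E" "transitive_for Y E" for E S
      using that unfolding stuck_def by blast
    \<comment> \<open>The old promises concern the columns below \<open>s\<close> only, so column
      \<open>s\<close> is free to receive \<open>Y\<close>.\<close>
    define X' where "X' = {m. if fst (prod_decode m) = s then snd (prod_decode m) \<in> Y else m \<in> X}"
    have col: "column X' i = (if i = s then Y else column X i)" for i
      by (auto simp: column_def X'_def)
    have "avoids (Suc s) (?F \<union> {n1}) n2 (insert s ?Z) X'"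
      unfolding avoids_def
    proof (intro allI impI ballI)
      fix E e S
      assume E: "finite E" "\<forall>x\<in>E. n2 \<le> x" "\<forall>i<Suc s. transitive_for (column X' i) E"
        and e: "e \<in> insert s ?Z"
      have XE: "\<forall>i<s. transitive_for (column X i) E" and YE: "transitive_for Y E"
        using E(3) col by (metis less_SucI less_irrefl, metis lessI)
      show "\<not> halts e S (?F \<union> {n1} \<union> E)"
        using Y[OF E(1,2) XE YE] n2'(1) E(1,2) XE e unfolding avoids_def by blast
    qed
    moreover obtain c' where "stem c' = ?F \<union> {n1}" "bound c' = n2" "diverging c' = insert s ?Z"
      using code[of "?F \<union> {n1}" "insert s ?Z" n2] by auto
    ultimately have "extends s c c' \<and> valid g (Suc s) c'"
      using n1 n2'(2,3) unfolding extends_def valid_def by auto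
    then show ?thesis ..
  next
    case False
    then obtain E S where E: "finite E" "\<forall>x\<in>E. n2 \<le> x" "\<forall>i<s. transitive_for (column X i) E"
      "g_transitive g E" and S: "halts s S (?F \<union> {n1} \<union> E)"
      unfolding stuck_def using transitive_for_graph[OF g] by meson
    have "g_transitive g ({n1} \<union> E)"
      by (rule g_transitive_Un[OF trans_singleton(2) E(4), of n2]) (use n2'(3) E(2) in auto)
    moreover have "n1 \<le> x" if "x \<in> {n1} \<union> E" for x
      using that E(2) n2 by auto
    moreover have "transitive_for (column X i) ({n1} \<union> E)" if "i < s" for i
      using tail E(2,3) that by blast
    \<comment> \<open>\<open>Suc S\<close> puts the code of the halting computation strictly below
      the new bound.\<close>
    ultimately have "\<exists>n'\<ge>Suc S. ext ({n1} \<union> E) n'"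
      using E(1) by (intro extend) auto
    then obtain n3 where n3: "Suc S \<le> n3" and ext: "ext ({n1} \<union> E) n3" by blast
    have n3': "avoids s (?F \<union> ({n1} \<union> E)) n3 ?Z X"
      "g_transitive g (?F \<union> ({n1} \<union> E))" "\<forall>x\<in>?F \<union> ({n1} \<union> E). x < n3 \<and> g x \<le> n3"
      using ext unfolding ext_def by blast+
    \<comment> \<open>Respecting one more column only restricts the admissible extensions, whatever
      that column is.\<close>
    have "avoids (Suc s) (?F \<union> ({n1} \<union> E)) n3 ?Z X"
      using n3'(1) unfolding avoids_def by (meson less_SucI)
    moreover obtain c' where c': "stem c' = ?F \<union> ({n1} \<union> E)" "bound c' = n3" "diverging c' = ?Z"
      using code[of "?F \<union> ({n1} \<union> E)" ?Z n3] E(1) by auto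
    moreover have "\<forall>x\<in>stem c'. x \<in> ?F \<or> bound c \<le> x"
      using c'(1) n1 n2 E(2) by fastforce
    moreover have "\<exists>S<bound c'. halts s S (stem c')"
      using S n3 c' by (metis Suc_le_lessD sup_assoc)
    ultimately have "extends s c c' \<and> valid g (Suc s) c'"
      using n1 n3'(2,3) unfolding extends_def valid_def by auto
    then show ?thesis ..
  qed
qed

section \<open>Decidability of conditions and extensions\<close>

lemma decidable_in_avoids_upto:
  assumes "computable_in A s" "computable_in A F" "computable_in A n" "computable_in A Z"
    "computable_in A N" "computable_in A D"
  shows "decidable_in A (\<lambda>x. avoids_upto (s x) (set_decode (F x)) (n x) (set_decode (Z x)) (N x)
    (set_decode (D x)))"
  unfolding avoids_upto_def transitive_for_def large_def column_def mem_Collect_eq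
  by (intro computable decidable_in_halts assms assms[THEN computable_in_comp])

text \<open>The approximations do not mention \<open>g\<close> and are decidable without an oracle,
  so one jump handles the quantifier over \<open>N\<close>. The values of \<open>g\<close> enter
  only through bounded conditions on the finite stem, and the jump computes them.\<close>

lemma decidable_in_valid:
  assumes g: "computable_in (turing_jump {}) g"
    and sc: "computable_in (turing_jump {}) s" "computable_in (turing_jump {}) c"
  shows "decidable_in (turing_jump {}) (\<lambda>x. valid g (s x) (c x))"
proof -
  let ?K = "turing_jump {}"
  have "decidable_in {} (\<lambda>e. \<exists>D<2 ^ snd (prod_decode e). avoids_upto (fst (prod_decode (fst (prod_decode e))))
      (stem (snd (prod_decode (fst (prod_decode e))))) (bound (snd (prod_decode (fst (prod_decode e)))))
      (diverging (snd (prod_decode (fst (prod_decode e))))) (snd (prod_decode e)) (set_decode D))"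
    by (intro computable decidable_in_avoids_upto)
  from decidable_in_jump_all[of _ "\<lambda>x N. \<exists>D<2 ^ N. avoids_upto (fst (prod_decode x)) (stem (snd (prod_decode x)))
      (bound (snd (prod_decode x))) (diverging (snd (prod_decode x))) N (set_decode D)", OF this]
  have "decidable_in ?K (\<lambda>x. \<exists>X. avoids (fst (prod_decode x)) (stem (snd (prod_decode x)))
      (bound (snd (prod_decode x))) (diverging (snd (prod_decode x))) X)"
    unfolding ex_avoids_iff .
  from decidable_in_comp[OF this computable_in_pair[OF sc]]
  have "decidable_in ?K (\<lambda>x. \<exists>X. avoids (s x) (stem (c x)) (bound (c x)) (diverging (c x)) X)"
    by simp
  then show ?thesis
    unfolding valid_def g_transitive_def g_small_def g_large_def
    by (intro computable computable_in_comp[OF g] sc sc[THEN computable_in_comp])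
qed

lemma decidable_in_extends:
  assumes "computable_in A s" "computable_in A c" "computable_in A c'"
  shows "decidable_in A (\<lambda>x. extends (s x) (c x) (c' x))"
  unfolding extends_def
  by (intro computable decidable_in_halts[where E = "\<lambda>x. 0", simplified] assms assms[THEN computable_in_comp])

section \<open>Construction of the low set\<close>

theorem theorem5p18:
  fixes g :: "nat \<Rightarrow> nat"
  assumes "Delta_fun 2 g" and "mono g"
  shows "\<exists>H. infinite H \<and> g_transitive g H \<and> low H"
proof -
  let ?K = "turing_jump {}"
  have g: "computable_in ?K g" using assms(1) by (rule Delta_fun_2_computable)
  \<comment> \<open>The first disjunct makes the search total, as \<open>computable_in\<close> demands.\<close>
  define P where "P s c c' \<longleftrightarrow> \<not> valid g s c \<or> extends s c c' \<and> valid g (Suc s) c'" for s c c'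
  define step where "step s c = (LEAST c'. P s c c')" for s c
  define C where "C = rec_nat 0 step"
  have ex: "\<exists>c'. P s c c'" for s c
    using ex_extends[OF assms(2)] unfolding P_def by blast
  have P_step: "P s c (step s c)" for s c
    unfolding step_def using ex by (rule LeastI_ex)
  have C: "valid g s (C s) \<and> extends s (C s) (C (Suc s))" for s
  proof (induction s)
    case 0
    then show ?case using P_step[of 0 0] valid_zero by (simp add: C_def P_def)
  next
    case (Suc s)
    have "valid g (Suc s) (C (Suc s))" using P_step[of s "C s"] Suc by (simp add: C_def P_def)
    then show ?case using P_step[of "Suc s" "C (Suc s)"] by (simp add: C_def P_def)
  qed
  have "decidable_in ?K (\<lambda>e. P (fst (prod_decode (fst (prod_decode e)))) (snd (prod_decode (fst (prod_decode e))))
      (snd (prod_decode e)))"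
    unfolding P_def by (intro computable decidable_in_valid[OF g] decidable_in_extends)
  from computable_in_Least[of _ "\<lambda>x. P (fst (prod_decode x)) (snd (prod_decode x))", OF this ex]
  have step: "computable_in ?K (\<lambda>x. step (fst (prod_decode x)) (snd (prod_decode x)))"
    unfolding step_def .
  have "computable_in ?K (\<lambda>x. rec_nat 0 (\<lambda>m r. step m r) x)"
    using computable_in_comp[OF step computable_in_snd[OF computable_in_id]]
    by (intro computable_in_rec computable)
  then have C_comp: "computable_in ?K C" unfolding C_def .

  define H where "H = (\<Union>s. stem (C s))"
  have stem_lt: "x < bound (C s)" if "x \<in> stem (C s)" for x s
    using C[of s] that unfolding valid_def by blast
  have stem_mono: "s \<le> t \<Longrightarrow> stem (C s) \<subseteq> stem (C t)" for s t
    by (induction rule: dec_induct) (use C in \<open>auto simp: extends_def\<close>)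
  \<comment> \<open>The next stem contains an element at or above the old bound, and that element is
    below the new bound.\<close>
  have bound_less: "bound (C s) < bound (C (Suc s))" for s
    using C[of s] stem_lt[of _ "Suc s"] unfolding extends_def by (meson le_less_trans)
  have bound_ge: "s \<le> bound (C s)" for s
    by (induction s) (use bound_less in \<open>auto intro: Suc_leI le_less_trans\<close>)
  \<comment> \<open>Elements added later lie at or above the current bound, so each stem is an
    initial segment of \<open>H\<close>.\<close>
  have H_stem: "H \<inter> {..<bound (C s)} = stem (C s)" for s
  proof -
    have "x \<in> stem (C s)" if "s \<le> t" "x \<in> stem (C t)" "x < bound (C s)" for x t
      using that
    proof (induction t rule: dec_induct)
      case (step t)
      have "bound (C s) \<le> bound (C t)"
        using lift_Suc_mono_le[of "\<lambda>s. bound (C s)"] bound_less step.hyps(1) by (meson less_imp_le)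
      then show ?case using step C[of t] unfolding extends_def by fastforce
    qed
    then have "x \<in> stem (C s)" if "x \<in> stem (C t)" "x < bound (C s)" for x t
      using that stem_mono[of t s] by (cases "s \<le> t") auto
    then show ?thesis using stem_lt unfolding H_def by blast
  qed
  have inf: "infinite H"
  proof
    assume "finite H"
    then obtain m where m: "\<And>x. x \<in> H \<Longrightarrow> x < m" unfolding finite_nat_set_iff_bounded by blast
    obtain x where x: "x \<in> stem (C (Suc m))" "bound (C m) \<le> x"
      using C[of m] unfolding extends_def by blast
    then have "x \<in> H" unfolding H_def by blast
    then show False using m[of x] x(2) bound_ge[of m] by linarith
  qed
  have trans: "g_transitive g H"
    unfolding g_transitive_def
  proof (intro ballI impI)
    fix x y z
    assume "x \<in> H" "y \<in> H" "z \<in> H" and h: "x < y \<and> y < z \<and> g_small g x y \<and> g_small g y z"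
    moreover have "z < bound (C (Suc z))" using bound_ge[of "Suc z"] by simp
    ultimately have "x \<in> stem (C (Suc z))" "y \<in> stem (C (Suc z))" "z \<in> stem (C (Suc z))"
      unfolding H_stem[symmetric] by auto
    then show "g_small g x z"
      using C[of "Suc z"] h unfolding valid_def g_transitive_def by blast
  qed
  have halts_H: "halts e S H \<longleftrightarrow> halts e S (stem (C t))" if "S \<le> bound (C t)" for e S t
  proof -
    have "H \<inter> {..<S} = H \<inter> {..<bound (C t)} \<inter> {..<S}" using that by auto
    then have "H \<inter> {..<S} = stem (C t) \<inter> {..<S}" unfolding H_stem .
    then show ?thesis using halts_cong by metis
  qed
  \<comment> \<open>A computation found at stage \<open>s\<close> survives in \<open>H\<close>.
    Conversely, a computation in \<open>H\<close> is already present in some stem, where the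
    promise, applied to the empty extension, would forbid it.\<close>
  have jump: "s \<in> turing_jump H \<longleftrightarrow> s \<notin> diverging (C (Suc s))" for s
  proof
    assume s: "s \<notin> diverging (C (Suc s))"
    then obtain S where "S < bound (C (Suc s))" "halts s S (stem (C (Suc s)))"
      using C[of s] unfolding extends_def by blast
    then have "halts s S H" using halts_H[of S "Suc s" s] by simp
    then show "s \<in> turing_jump H" unfolding turing_jump_iff by blast
  next
    assume "s \<in> turing_jump H"
    then obtain S where S: "halts s S H" unfolding turing_jump_iff by blast
    \<comment> \<open>Stage \<open>t\<close> is late enough to inherit the declarations of stage
      \<open>Suc s\<close> and for its bound to exceed the use \<open>S\<close>.\<close>
    define t where "t = Suc s + S"
    have "diverging (C (Suc s)) \<subseteq> diverging (C t)"
    proof -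
      have "Suc s \<le> t" by (simp add: t_def)
      then show ?thesis
        by (induction rule: dec_induct) (use C in \<open>auto simp: extends_def\<close>)
    qed
    moreover have "halts s S (stem (C t) \<union> {})"
      using S halts_H[of S t s] bound_ge[of t] by (simp add: t_def)
    moreover have "transitive_for Y {}" for Y by (simp add: transitive_for_def)
    ultimately show "s \<notin> diverging (C (Suc s))"
      using C[of t] unfolding valid_def avoids_def by blast
  qed
  have "low H"
  proof -
    \<comment> \<open>Index \<open>s\<close> is decided in passing from \<open>C s\<close> to
      \<open>C (Suc s)\<close>, so a single stage, computed by the jump, gives the answer.\<close>
    have "decidable_in ?K (\<lambda>s. s \<notin> diverging (C (Suc s)))"
      by (intro computable computable_in_comp[OF C_comp])
    then show ?thesis unfolding low_def turing_le_def decidable_in_def jump .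
  qed
  with inf trans show ?thesis by blast
qed

end
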